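(* Let $\boldsymbol\beta$ be a non-increasing weight sequence, let $\mathcal X,\mathcal Y,\mathcal U$ be Hilbert spaces, and let $T\in\mathcal L(\mathcal X)$, $E\in\mathcal L(\mathcal X,\mathcal Y)$, $N\in\mathcal L(\mathcal X,\mathcal U)$ be such that $(E,T)$ is $\boldsymbol\beta$-output stable and $(N,T)$ is $\mathbf 1$-output stable. Then there exists a contractive multiplier $S\in\mathcal S_{\boldsymbol\beta}(\mathcal U,\mathcal Y)$ satisfying $$(E^*S)^{\wedge L}(T^* ):=\mathcal O_{\boldsymbol\beta,E,T}^*\,M_S|_{\mathcal U}=N^*$$ if and only if the operator $$P:=\mathcal G_{\boldsymbol\beta,E,T}-\mathcal G_{\mathbf 1,N,T}$$ is positive semidefinite.
   Context: $\mathbb D$ is the open unit disk; $\mathcal L(\cdot,\cdot)$ denotes bounded linear operators. A weight sequence is a sequence $\boldsymbol\beta=\{\beta_j\}_{j\ge0}$ of positive numbers with $\beta_0=1$ and $\liminf_j\beta_j^{1/j}\ge 1$; $\mathbf 1$ is the sequence of all ones. $H^2_{\boldsymbol\beta}(\mathcal Y)$ is the Hilbert space of $\mathcal Y$-valued power series $f(z)=\sum_{k\ge0}f_kz^k$ with $\|f\|^2=\sum_{k\ge0}\beta_k\|f_k\|_{\mathcal Y}^2<\infty$; $H^2(\mathcal U)=H^2_{\mathbf 1}(\mathcal U)$. $\mathcal S_{\boldsymbol\beta}(\mathcal U,\mathcal Y)$ is the set of $\mathcal L(\mathcal U,\mathcal Y)$-valued functions $S$ on $\mathbb D$ such that $M_S:f\mapsto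 Sf$ is a contraction from $H^2(\mathcal U)$ to $H^2_{\boldsymbol\beta}(\mathcal Y)$. $M_S|_{\mathcal U}$ is the restriction of $M_S$ to the constant functions, identified with $\mathcal U$. A pair $(E,T)$ with $T\in\mathcal L(\mathcal X)$, $E\in\mathcal L(\mathcal X,\mathcal Y)$ is $\boldsymbol\beta$-output stable if the observability operator $$\mathcal O_{\boldsymbol\beta,E,T}:x\mapsto\sum_{j=0}^\infty(\beta_j^{-1}ET^jx)z^j$$ maps $\mathcal X$ into $H^2_{\boldsymbol\beta}(\mathcal Y)$ and is bounded; then the observability gramian is $\mathcal G_{\boldsymbol\beta,E,T}=\mathcal O_{\boldsymbol\beta,E,T}^*\mathcal O_{\boldsymbol\beta,E,T}$. The same definitions with $\boldsymbol\beta=\mathbf 1$ and $(N,T)$ in place of $(E,T)$ give $\mathbf 1$-output stability, $\mathcal O_{\mathbf 1,N,T}:\mathcal X\to H^2(\mathcal U)$ and $\mathcal G_{\mathbf 1,N,T}$. *)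

theory Defs
  imports "HOL-Analysis.Analysis"
begin

text \<open>
  Complex Hilbert spaces. The inner product \<open>cinner\<close> is linear in its first and conjugate linear
  in its second argument. Its real part is the inner product of the underlying real Hilbert space,
  so that norm, topology and completeness are those of the parent classes;
  in particular \<open>norm x = sqrt (Re (cinner x x))\<close>.
\<close>

class complex_hilbert_space = real_inner + complete_space +
  fixes scaleC :: "complex \<Rightarrow> 'a \<Rightarrow> 'a"  (infixr "*\<^sub>C" 75)
    and cinner :: "'a \<Rightarrow> 'a \<Rightarrow> complex"
  assumes scaleC_add_right: "c *\<^sub>C (x + y) = c *\<^sub>C x + c *\<^sub>C y"
    and scaleC_add_left: "(c + d) *\<^sub>C x = c *\<^sub>C x + d *\<^sub>C x"
    and scaleC_scaleC: "c *\<^sub>C (d *\<^sub>C x) = (c * d) *\<^sub>C x"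
    and scaleC_of_real: "complex_of_real r *\<^sub>C x = r *\<^sub>R x"
    and cinner_commute: "cinner x y = cnj (cinner y x)"
    and cinner_add_left: "cinner (x + y) z = cinner x z + cinner y z"
    and cinner_scaleC_left: "cinner (c *\<^sub>C x) y = c * cinner x y"
    and Re_cinner: "Re (cinner x y) = inner x y"

instantiation complex :: complex_hilbert_space
begin

definition scaleC_complex_def: "scaleC c (x::complex) = c * x"
definition cinner_complex_def: "cinner x (y::complex) = x * cnj y"

instance
  by standard
    (simp_all add: scaleC_complex_def cinner_complex_def algebra_simps scaleR_conv_of_real
      inner_complex_def)

end

definition bounded_clinear ::
    "('a::complex_hilbert_space \<Rightarrow> 'b::complex_hilbert_space) \<Rightarrow> bool" where
  "bounded_clinear A \<longleftrightarrow> bounded_linear A \<and> (\<forall>c x. A (c *\<^sub>C x) = c *\<^sub>C A x)"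

text \<open>
  The adjoint of a bounded operator \<open>A\<close> from a complex Hilbert space into a Hilbert space with inner
  product \<open>ip\<close>. The latter is a parameter because the weighted Hardy spaces below depend on a
  weight sequence and are therefore not types.
\<close>

definition hadjoint ::
    "('h \<Rightarrow> 'h \<Rightarrow> complex) \<Rightarrow> ('a::complex_hilbert_space \<Rightarrow> 'h) \<Rightarrow> 'h \<Rightarrow> 'a" where
  "hadjoint ip A h = (THE w. \<forall>x. cinner w x = ip h (A x))"

definition positive_semidefinite :: "('a::complex_hilbert_space \<Rightarrow> 'a) \<Rightarrow> bool" where
  "positive_semidefinite P \<longleftrightarrow> (\<forall>x. cinner (P x) x \<in> \<real> \<and> 0 \<le> Re (cinner (P x) x))"

text \<open>The limit inferior is taken in \<open>ereal\<close>, since it may be infinite.\<close>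

definition weight_sequence :: "(nat \<Rightarrow> real) \<Rightarrow> bool" where
  "weight_sequence \<beta> \<longleftrightarrow>
     (\<forall>j. 0 < \<beta> j) \<and> \<beta> 0 = 1 \<and> 1 \<le> liminf (\<lambda>j. ereal (root j (\<beta> j)))"

abbreviation unit_weight :: "nat \<Rightarrow> real" where
  "unit_weight \<equiv> \<lambda>_. 1"

text \<open>
  Elements of the weighted Hardy space are power series, given by their coefficient sequences;
  \<open>represents f F\<close> says that \<open>F\<close> is the function on the open unit disk with power series \<open>f\<close>.
\<close>

definition H2 :: "(nat \<Rightarrow> real) \<Rightarrow> (nat \<Rightarrow> 'y::complex_hilbert_space) set" where
  "H2 \<beta> = {f. summable (\<lambda>k. \<beta> k * (norm (f k))\<^sup>2)}"

definition H2_norm :: "(nat \<Rightarrow> real) \<Rightarrow> (nat \<Rightarrow> 'y::complex_hilbert_space) \<Rightarrow> real" where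
  "H2_norm \<beta> f = sqrt (\<Sum>k. \<beta> k * (norm (f k))\<^sup>2)"

definition H2_cinner ::
    "(nat \<Rightarrow> real) \<Rightarrow> (nat \<Rightarrow> 'y::complex_hilbert_space) \<Rightarrow> (nat \<Rightarrow> 'y) \<Rightarrow> complex" where
  "H2_cinner \<beta> f g = (\<Sum>k. complex_of_real (\<beta> k) * cinner (f k) (g k))"

definition represents ::
    "(nat \<Rightarrow> 'y::complex_hilbert_space) \<Rightarrow> (complex \<Rightarrow> 'y) \<Rightarrow> bool" where
  "represents f F \<longleftrightarrow> (\<forall>z\<in>ball 0 1. (\<lambda>k. z ^ k *\<^sub>C f k) sums F z)"

definition series_eval :: "(nat \<Rightarrow> 'y::complex_hilbert_space) \<Rightarrow> complex \<Rightarrow> 'y" where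
  "series_eval f z = (\<Sum>k. z ^ k *\<^sub>C f k)"

definition const_series :: "'u::complex_hilbert_space \<Rightarrow> nat \<Rightarrow> 'u" where
  "const_series u = (\<lambda>k. if k = 0 then u else 0)"

text \<open>
  The power series \<open>M_S f\<close> of the pointwise product \<open>S f\<close>; it is unique whenever it exists. Only the
  values of \<open>S\<close> on the open unit disk matter.
\<close>

definition mult_op ::
    "(complex \<Rightarrow> 'u::complex_hilbert_space \<Rightarrow> 'y::complex_hilbert_space)
      \<Rightarrow> (nat \<Rightarrow> 'u) \<Rightarrow> (nat \<Rightarrow> 'y)" where
  "mult_op S f = (THE g. represents g (\<lambda>z. S z (series_eval f z)))"

definition contractive_multipliers ::
    "(nat \<Rightarrow> real)
      \<Rightarrow> (complex \<Rightarrow> 'u::complex_hilbert_space \<Rightarrow> 'y::complex_hilbert_space) set" where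
  "contractive_multipliers \<beta> =
     {S. (\<forall>z\<in>ball 0 1. bounded_clinear (S z)) \<and>
         (\<forall>f\<in>H2 unit_weight. \<exists>g\<in>H2 \<beta>.
            represents g (\<lambda>z. S z (series_eval f z)) \<and>
            H2_norm \<beta> g \<le> H2_norm unit_weight f)}"

definition observability ::
    "(nat \<Rightarrow> real) \<Rightarrow> ('x::complex_hilbert_space \<Rightarrow> 'y::complex_hilbert_space)
      \<Rightarrow> ('x \<Rightarrow> 'x) \<Rightarrow> 'x \<Rightarrow> (nat \<Rightarrow> 'y)" where
  "observability \<beta> E T x = (\<lambda>j. inverse (\<beta> j) *\<^sub>R E ((T ^^ j) x))"

definition output_stable ::
    "(nat \<Rightarrow> real) \<Rightarrow> ('x::complex_hilbert_space \<Rightarrow> 'y::complex_hilbert_space)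
      \<Rightarrow> ('x \<Rightarrow> 'x) \<Rightarrow> bool" where
  "output_stable \<beta> E T \<longleftrightarrow>
     (\<forall>x. observability \<beta> E T x \<in> H2 \<beta>) \<and>
     (\<exists>K. \<forall>x. H2_norm \<beta> (observability \<beta> E T x) \<le> K * norm x)"

definition gramian ::
    "(nat \<Rightarrow> real) \<Rightarrow> ('x::complex_hilbert_space \<Rightarrow> 'y::complex_hilbert_space)
      \<Rightarrow> ('x \<Rightarrow> 'x) \<Rightarrow> 'x \<Rightarrow> 'x" where
  "gramian \<beta> E T x =
     hadjoint (H2_cinner \<beta>) (observability \<beta> E T) (observability \<beta> E T x)"

text \<open>\<open>left_value \<beta> E T S\<close> is the left evaluation of \<open>E\<^sup>* S\<close> at \<open>T\<^sup>*\<close>.\<close>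

definition left_value ::
    "(nat \<Rightarrow> real) \<Rightarrow> ('x::complex_hilbert_space \<Rightarrow> 'y::complex_hilbert_space)
      \<Rightarrow> ('x \<Rightarrow> 'x) \<Rightarrow> (complex \<Rightarrow> 'u::complex_hilbert_space \<Rightarrow> 'y) \<Rightarrow> 'u \<Rightarrow> 'x" where
  "left_value \<beta> E T S u =
     hadjoint (H2_cinner \<beta>) (observability \<beta> E T) (mult_op S (const_series u))"

end

theory Submission
  imports Defs "HOL-Library.Function_Algebras"
begin

text \<open>
  A contractive multiplier \<open>S\<close> satisfies \<open>M\<^sub>S (z\<^sup>j u) = z\<^sup>j M\<^sub>S u\<close>, so the interpolation condition
  amounts to \<open>M\<^sub>S\<^sup>* \<O>\<^sub>\<beta> = \<O>\<^sub>1\<close>, where \<open>\<O>\<^sub>\<beta>\<close>, \<open>\<O>\<^sub>1\<close> are the observability operators of \<open>(E, T)\<close>,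
  \<open>(N, T)\<close>; hence \<open>\<parallel>\<O>\<^sub>1 x\<parallel> \<le> \<parallel>\<O>\<^sub>\<beta> x\<parallel>\<close>, which is \<open>P \<ge> 0\<close>. Conversely, if \<open>P \<ge> 0\<close>, then
  \<open>\<O>\<^sub>\<beta> x \<mapsto> \<O>\<^sub>1 x\<close> is a contraction commuting with the backward shifts. It is extended to
  \<open>\<O>\<^sub>\<beta> x + p\<close> for polynomials \<open>p\<close> one degree at a time. Let \<open>X\<close> be the extension to degrees less than
  \<open>n\<close>, and \<open>\<sigma>\<close> the backward shift of the weighted space, a contraction because \<open>\<beta>\<close> is non-increasing.
  Commutation prescribes all coefficients of \<open>X' f\<close> for \<open>f\<close> of degree up to \<open>n\<close> except the constant
  one, which has to satisfy \<open>\<parallel>(X' f)\<^sub>0\<parallel>\<^sup>2 \<le> \<parallel>f\<parallel>\<^sup>2 - \<parallel>X \<sigma> f\<parallel>\<^sup>2\<close>. The right-hand side is a positive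
  semidefinite quadratic form, and the bound holds for degrees less than \<open>n\<close>, so the constant coefficient
  extends as a contraction for this form. In the limit one obtains \<open>M\<^sub>S\<^sup>*\<close>, whence \<open>S\<close>.
\<close>

section \<open>Extension of contractions on semi-inner product spaces\<close>

text \<open>A discriminant bound: for \<open>A > 0\<close> the quadratic has its minimum
  \<open>- C\<^sup>2 / A\<close> at \<open>t = - C / A\<close>. For \<open>A = 0\<close> it is
  linear in \<open>t\<close>, and being bounded below forces slope zero.\<close>

lemma quadratic_bounded_below:
  fixes A C e :: real
  assumes "\<And>t. - e \<le> t\<^sup>2 * A + 2 * t * C" and "0 \<le> A"
  shows "C\<^sup>2 \<le> e * A"
proof (cases "A = 0")
  case True
  have "C = 0"
  proof (rule ccontr)
    assume "C \<noteq> 0"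
    then show False
      \<comment> \<open>At this \<open>t\<close> the right-hand side equals
        \<open>- (e + 1)\<close>.\<close>
      using assms(1)[of "- ((e + 1) / (2 * C))"] True by simp
  qed
  with True show ?thesis by simp
next
  case False
  with assms(2) have A: "0 < A" by simp
  have "- e \<le> (- C / A)\<^sup>2 * A + 2 * (- C / A) * C" by (rule assms(1))
  also have "\<dots> = - (C\<^sup>2 / A)" using A by (simp add: field_simps power2_eq_square)
  finally show ?thesis using A by (simp add: field_simps)
qed

text \<open>\<open>Q\<close> may be degenerate: the form needed later is the defect of a
  contraction, which can vanish on nonzero vectors.\<close>

locale psd_form =
  fixes Q :: "'a::real_vector \<Rightarrow> 'a \<Rightarrow> real"
  assumes sym: "Q a b = Q b a"
    and linear_left: "linear (\<lambda>a. Q a b)"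
    and nonneg: "0 \<le> Q a a"
begin

lemma add_left: "Q (a + b) c = Q a c + Q b c"
  and diff_left: "Q (a - b) c = Q a c - Q b c"
  and scale_left: "Q (r *\<^sub>R a) c = r * Q a c"
  and zero_left: "Q 0 c = 0"
  using linear_add[OF linear_left[of c]] linear_diff[OF linear_left[of c]]
    linear_scale[OF linear_left[of c]] linear_0[OF linear_left[of c]] by auto

lemma add_right: "Q c (a + b) = Q c a + Q c b"
  and diff_right: "Q c (a - b) = Q c a - Q c b"
  and scale_right: "Q c (r *\<^sub>R a) = r * Q c a"
  by (simp_all add: sym[of c] add_left diff_left scale_left)

lemmas expand = add_left diff_left scale_left add_right diff_right scale_right

lemma add_scale: "Q (a + t *\<^sub>R b) (a + t *\<^sub>R b) = Q a a + t\<^sup>2 * Q b b + 2 * t * Q a b"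
  using sym[of a b] by (simp add: expand power2_eq_square algebra_simps)

lemma Cauchy_Schwarz: "\<bar>Q a b\<bar> \<le> sqrt (Q a a) * sqrt (Q b b)"
proof -
  have "(Q a b)\<^sup>2 \<le> Q a a * Q b b"
  proof (rule quadratic_bounded_below)
    show "- Q a a \<le> t\<^sup>2 * Q b b + 2 * t * Q a b" for t
      using nonneg[of "a + t *\<^sub>R b"] by (simp add: add_scale)
  qed (rule nonneg)
  then show ?thesis
    using real_sqrt_le_mono by (fastforce simp: real_sqrt_mult)
qed

text \<open>Riesz representation without completeness. \<open>Q (m n) v - \<phi> v\<close> is half
  the first variation of \<open>F\<close> at \<open>m n\<close> in direction \<open>v\<close>; if
  \<open>m n\<close> minimizes \<open>F\<close> up to \<open>1 / (n + 1)\<close>, the discriminant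
  bound makes it small relative to the seminorm of \<open>v\<close>.\<close>

lemma approximate_representation:
  assumes W: "subspace W" and \<phi>: "linear \<phi>"
    and bound: "\<And>v. v \<in> W \<Longrightarrow> \<bar>\<phi> v\<bar> \<le> C * sqrt (Q v v)"
  obtains m \<delta> where "\<And>n. m n \<in> W" "\<delta> \<longlonglongrightarrow> 0"
    "\<And>n v. v \<in> W \<Longrightarrow> \<bar>Q (m n) v - \<phi> v\<bar> \<le> \<delta> n * sqrt (Q v v)"
proof -
  define F where "F v = Q v v - 2 * \<phi> v" for v
  \<comment> \<open>Completing the square: \<open>s\<^sup>2 - 2 * C * s \<ge> - C\<^sup>2\<close>
    for \<open>s = sqrt (Q v v)\<close>.\<close>
  have lower: "- C\<^sup>2 \<le> F v" if "v \<in> W" for v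
  proof -
    have "F v \<ge> (sqrt (Q v v))\<^sup>2 - 2 * (C * sqrt (Q v v))"
      unfolding F_def using bound[OF that] nonneg[of v] by auto
    moreover have "0 \<le> (sqrt (Q v v) - C)\<^sup>2" by simp
    ultimately show ?thesis by (simp add: power2_diff algebra_simps)
  qed
  have bdd: "bdd_below (F ` W)" using lower by (auto intro!: bdd_belowI2)
  have "0 \<in> W" using W by (rule subspace_0)
  have "\<exists>v\<in>W. F v < Inf (F ` W) + inverse (real (Suc n))" for n
    using cInf_lessD[of "F ` W" "Inf (F ` W) + inverse (real (Suc n))"] \<open>0 \<in> W\<close> by auto
  then obtain m where m: "\<And>n. m n \<in> W"
    and F_m: "\<And>n. F (m n) < Inf (F ` W) + inverse (real (Suc n))" by metis
  show ?thesis
  proof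
    show "m n \<in> W" for n by (rule m)
    show "(\<lambda>n. sqrt (inverse (real (Suc n)))) \<longlonglongrightarrow> 0"
      using tendsto_real_sqrt[OF LIMSEQ_inverse_real_of_nat] by simp
    show "\<bar>Q (m n) v - \<phi> v\<bar> \<le> sqrt (inverse (real (Suc n))) * sqrt (Q v v)" if v: "v \<in> W" for n v
    proof -
      have "(Q (m n) v - \<phi> v)\<^sup>2 \<le> inverse (real (Suc n)) * Q v v"
      proof (rule quadratic_bounded_below)
        fix t
        have "Inf (F ` W) \<le> F (m n + t *\<^sub>R v)"
          using m v W bdd by (intro cInf_lower) (auto intro: subspace_add subspace_scale)
        also have "\<dots> = F (m n) + t\<^sup>2 * Q v v + 2 * t * (Q (m n) v - \<phi> v)"
          by (simp add: F_def add_scale linear_add[OF \<phi>] linear_scale[OF \<phi>] algebra_simps)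
        finally show "- inverse (real (Suc n)) \<le> t\<^sup>2 * Q v v + 2 * t * (Q (m n) v - \<phi> v)"
          using F_m[of n] by linarith
      qed (rule nonneg)
      then show ?thesis
        using real_sqrt_le_mono by (fastforce simp: real_sqrt_mult)
    qed
  qed
qed

text \<open>Testing two approximants on their own difference \<open>v\<close> writes
  \<open>Q v v\<close> as a difference of two errors, so \<open>sqrt (Q v v) \<le> \<bar>\<delta>
  n\<bar> + \<bar>\<delta> k\<bar>\<close>. \<open>L\<close> carries this seminorm estimate over to
  a norm.\<close>

lemma approximate_Cauchy:
  assumes W: "subspace W" and m: "\<And>n. m n \<in> W" and \<delta>: "\<delta> \<longlonglongrightarrow> 0"
    and approx: "\<And>n v. v \<in> W \<Longrightarrow> \<bar>Q (m n) v - \<phi> v\<bar> \<le> \<delta> n * sqrt (Q v v)"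
    and L: "linear L" "\<And>v. v \<in> W \<Longrightarrow> norm (L v :: 'b::real_normed_vector) \<le> sqrt (Q v v)"
  shows "Cauchy (\<lambda>n. L (m n))"
proof (rule CauchyI)
  fix e :: real assume e: "0 < e"
  have le: "norm (L (m n) - L (m k)) \<le> \<bar>\<delta> n\<bar> + \<bar>\<delta> k\<bar>" for n k
  proof -
    define v where "v = m n - m k"
    have v: "v \<in> W" unfolding v_def using W m by (auto intro: subspace_diff)
    define s where "s = sqrt (Q v v)"
    have s: "0 \<le> s" "s\<^sup>2 = Q v v" using nonneg[of v] by (auto simp: s_def)
    have "Q v v = (Q (m n) v - \<phi> v) - (Q (m k) v - \<phi> v)" by (simp add: v_def diff_left)
    also have "\<dots> \<le> \<delta> n * s + \<delta> k * s"
      using approx[OF v, of n] approx[OF v, of k] unfolding s_def by linarith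
    also have "\<dots> \<le> (\<bar>\<delta> n\<bar> + \<bar>\<delta> k\<bar>) * s"
      unfolding distrib_right using s(1) by (intro add_mono mult_right_mono) auto
    finally have "s * s \<le> (\<bar>\<delta> n\<bar> + \<bar>\<delta> k\<bar>) * s" using s by (simp add: power2_eq_square)
    then have "s \<le> \<bar>\<delta> n\<bar> + \<bar>\<delta> k\<bar>" using s(1) by (cases "s = 0") auto
    moreover have "norm (L (m n) - L (m k)) \<le> s"
      using L(2)[OF v] by (simp add: v_def s_def linear_diff[OF L(1)])
    ultimately show ?thesis by linarith
  qed
  obtain M where M: "\<And>n. n \<ge> M \<Longrightarrow> \<bar>\<delta> n\<bar> < e / 2"
    using LIMSEQ_D[OF \<delta>, of "e / 2"] e by auto
  show "\<exists>M. \<forall>m'\<ge>M. \<forall>n\<ge>M. norm (L (m m') - L (m n)) < e"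
  proof (intro exI allI impI)
    fix n k assume "M \<le> n" "M \<le> k"
    then show "norm (L (m n) - L (m k)) < e" using M[of n] M[of k] le[of n k] by linarith
  qed
qed

text \<open>
  Projecting onto \<open>W\<close> would extend the contraction \<open>L\<close>; as \<open>W\<close> need not be complete, the
  projection of a vector is replaced by a minimizing sequence in \<open>W\<close>.
\<close>

lemma contraction_extension:
  fixes L :: "'a \<Rightarrow> 'b::{real_normed_vector,complete_space}"
  assumes W: "subspace W" and L: "linear L"
    and L_le: "\<And>v. v \<in> W \<Longrightarrow> norm (L v) \<le> sqrt (Q v v)"
  obtains L' where "linear L'" "\<And>v. v \<in> W \<Longrightarrow> L' v = L v" "\<And>a. norm (L' a) \<le> sqrt (Q a a)"
proof -
  \<comment> \<open>\<open>R a u\<close>: \<open>u\<close> is the limit of \<open>L\<close> along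
    some sequence in \<open>W\<close> that approximates the projection of \<open>a\<close>. As a
    relation it is visibly additive and homogeneous; that \<open>u\<close> does not depend on the
    sequence follows from the norm bound \<open>R_le\<close>.\<close>
  define R where "R a u \<longleftrightarrow> (\<exists>m \<delta>. (\<forall>n. m n \<in> W) \<and> \<delta> \<longlonglongrightarrow> 0 \<and>
    (\<forall>n. \<forall>v\<in>W. \<bar>Q (m n - a) v\<bar> \<le> \<delta> n * sqrt (Q v v)) \<and> (\<lambda>n. L (m n)) \<longlonglongrightarrow> u)" for a u
  have R_add: "R (a + b) (u + w)" if "R a u" "R b w" for a b u w
  proof -
    obtain m \<delta> where m: "\<And>n. m n \<in> W" "\<delta> \<longlonglongrightarrow> 0" "(\<lambda>n. L (m n)) \<longlonglongrightarrow> u"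
      "\<And>n v. v \<in> W \<Longrightarrow> \<bar>Q (m n - a) v\<bar> \<le> \<delta> n * sqrt (Q v v)"
      using \<open>R a u\<close> unfolding R_def by blast
    obtain m' \<delta>' where m': "\<And>n. m' n \<in> W" "\<delta>' \<longlonglongrightarrow> 0" "(\<lambda>n. L (m' n)) \<longlonglongrightarrow> w"
      "\<And>n v. v \<in> W \<Longrightarrow> \<bar>Q (m' n - b) v\<bar> \<le> \<delta>' n * sqrt (Q v v)"
      using \<open>R b w\<close> unfolding R_def by blast
    have "\<bar>Q (m n + m' n - (a + b)) v\<bar> \<le> (\<delta> n + \<delta>' n) * sqrt (Q v v)" if "v \<in> W" for n v
    proof -
      have "Q (m n + m' n - (a + b)) v = Q (m n - a) v + Q (m' n - b) v" by (simp add: expand)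
      then show ?thesis using m(4)[OF that, of n] m'(4)[OF that, of n]
        by (simp add: algebra_simps)
    qed
    moreover have "(\<lambda>n. L (m n + m' n)) \<longlonglongrightarrow> u + w"
      unfolding linear_add[OF L] by (intro tendsto_intros m m')
    moreover have "(\<lambda>n. \<delta> n + \<delta>' n) \<longlonglongrightarrow> 0" using tendsto_add[OF m(2) m'(2)] by simp
    ultimately show ?thesis unfolding R_def
      by (intro exI[of _ "\<lambda>n. m n + m' n"] exI[of _ "\<lambda>n. \<delta> n + \<delta>' n"])
        (use m(1) m'(1) W in \<open>auto intro: subspace_add\<close>)
  qed
  have R_scale: "R (r *\<^sub>R a) (r *\<^sub>R u)" if "R a u" for r a u
  proof -
    obtain m \<delta> where m: "\<And>n. m n \<in> W" "\<delta> \<longlonglongrightarrow> 0" "(\<lambda>n. L (m n)) \<longlonglongrightarrow> u"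
      "\<And>n v. v \<in> W \<Longrightarrow> \<bar>Q (m n - a) v\<bar> \<le> \<delta> n * sqrt (Q v v)"
      using \<open>R a u\<close> unfolding R_def by blast
    have "\<bar>Q (r *\<^sub>R m n - r *\<^sub>R a) v\<bar> \<le> (\<bar>r\<bar> * \<delta> n) * sqrt (Q v v)" if "v \<in> W" for n v
    proof -
      have "Q (r *\<^sub>R m n - r *\<^sub>R a) v = r * Q (m n - a) v" by (simp add: expand algebra_simps)
      then show ?thesis using mult_left_mono[OF m(4)[OF that, of n], of "\<bar>r\<bar>"]
        by (simp add: abs_mult mult.assoc)
    qed
    moreover have "(\<lambda>n. L (r *\<^sub>R m n)) \<longlonglongrightarrow> r *\<^sub>R u"
      unfolding linear_scale[OF L] by (intro tendsto_intros m)
    moreover have "(\<lambda>n. \<bar>r\<bar> * \<delta> n) \<longlonglongrightarrow> 0" using tendsto_mult_left[OF m(2), of "\<bar>r\<bar>"] by simp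
    ultimately show ?thesis unfolding R_def
      by (intro exI[of _ "\<lambda>n. r *\<^sub>R m n"] exI[of _ "\<lambda>n. \<bar>r\<bar> * \<delta> n"])
        (use m(1) W in \<open>auto intro: subspace_scale\<close>)
  qed
  \<comment> \<open>With \<open>s\<close> the seminorm of \<open>m n\<close>, expanding
    \<open>Q a a\<close> around \<open>m n\<close> gives
    \<open>(s - \<delta> n)\<^sup>2 \<le> Q a a + (\<delta> n)\<^sup>2\<close>. Then
    \<open>n\<close> tends to infinity.\<close>
  have R_le: "norm u \<le> sqrt (Q a a)" if "R a u" for a u
  proof -
    obtain m \<delta> where m: "\<And>n. m n \<in> W" "\<delta> \<longlonglongrightarrow> 0" "(\<lambda>n. L (m n)) \<longlonglongrightarrow> u"
      "\<And>n v. v \<in> W \<Longrightarrow> \<bar>Q (m n - a) v\<bar> \<le> \<delta> n * sqrt (Q v v)"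
      using \<open>R a u\<close> unfolding R_def by blast
    have "norm (L (m n)) \<le> \<delta> n + sqrt (Q a a + (\<delta> n)\<^sup>2)" for n
    proof -
      define s where "s = sqrt (Q (m n) (m n))"
      have s: "s\<^sup>2 = Q (m n) (m n)" using nonneg by (auto simp: s_def)
      have "Q a a = Q (m n) (m n) - 2 * Q (m n - a) (m n) + Q (m n - a) (m n - a)"
        using sym[of a "m n"] by (simp add: expand)
      moreover have "Q (m n - a) (m n) \<le> \<delta> n * s" using m(4)[OF m(1)[of n], of n] by (simp add: s_def)
      ultimately have "Q a a + (\<delta> n)\<^sup>2 \<ge> (s - \<delta> n)\<^sup>2"
        using nonneg[of "m n - a"] s by (simp add: power2_diff algebra_simps)
      then have "s - \<delta> n \<le> sqrt (Q a a + (\<delta> n)\<^sup>2)" by (rule real_le_rsqrt)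
      with L_le[OF m(1)[of n]] show ?thesis by (simp add: s_def)
    qed
    moreover have "(\<lambda>n. \<delta> n + sqrt (Q a a + (\<delta> n)\<^sup>2)) \<longlonglongrightarrow> 0 + sqrt (Q a a + 0\<^sup>2)"
      by (intro tendsto_intros m)
    ultimately show ?thesis
      using tendsto_norm[OF m(3)] LIMSEQ_le by (metis (no_types, lifting) add_0 add_0_right power_zero_numeral)
  qed
  have R_total: "\<exists>u. R a u" for a
  proof -
    obtain m \<delta> where m: "\<And>n. m n \<in> W" "\<delta> \<longlonglongrightarrow> 0"
      and approx: "\<And>n v. v \<in> W \<Longrightarrow> \<bar>Q (m n) v - Q a v\<bar> \<le> \<delta> n * sqrt (Q v v)"
    proof (rule approximate_representation[OF W, of "Q a" "sqrt (Q a a)"])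
      have "(\<lambda>b. Q b a) = Q a" by (rule ext) (rule sym)
      then show "linear (Q a)" using linear_left[of a] by simp
    qed (use Cauchy_Schwarz in auto)
    have "Cauchy (\<lambda>n. L (m n))" by (rule approximate_Cauchy[OF W m approx L L_le])
    then obtain u where "(\<lambda>n. L (m n)) \<longlonglongrightarrow> u" using Cauchy_convergent_iff convergent_def by metis
    then have "R a u" unfolding R_def
      by (intro exI[of _ m] exI[of _ \<delta>]) (use m approx in \<open>auto simp: expand\<close>)
    then show ?thesis ..
  qed
  \<comment> \<open>By linearity of \<open>R\<close>, \<open>u - w\<close> is related to
    \<open>a - a = 0\<close>, so its norm is at most \<open>sqrt (Q 0 0) = 0\<close>.\<close>
  have R_unique: "u = w" if "R a u" "R a w" for a u w
    using R_le[OF R_add[OF that(1) R_scale[OF that(2), of "-1"]]] by (simp add: zero_left)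
  define L' where "L' a = (SOME u. R a u)" for a
  have L': "R a (L' a)" for a unfolding L'_def using R_total by (rule someI_ex)
  show ?thesis
  proof
    show "linear L'"
      by (rule linearI) (auto intro!: R_unique[OF L'] R_add R_scale L')
    \<comment> \<open>A vector of \<open>W\<close> is its own projection: constant sequence, error
      zero.\<close>
    show "L' v = L v" if "v \<in> W" for v
      by (rule R_unique[OF L'], unfold R_def, rule exI[of _ "\<lambda>_. v"], rule exI[of _ "\<lambda>_. 0"])
        (use that in \<open>auto simp: zero_left\<close>)
    show "norm (L' a) \<le> sqrt (Q a a)" for a by (rule R_le[OF L'])
  qed
qed

end

section \<open>Riesz representation and adjoints on real Hilbert spaces\<close>

lemma psd_form_inner: "psd_form (inner :: 'a::real_inner \<Rightarrow> _)"
  by unfold_locales (auto simp: inner_add_left intro: inner_commute intro!: linearI)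

text \<open>Approximate representation on the whole space; with \<open>L\<close> the identity the
  approximants are Cauchy, and completeness supplies the representing vector as their limit.\<close>

lemma Riesz_representation:
  fixes \<phi> :: "'a::{real_inner,complete_space} \<Rightarrow> real"
  assumes "bounded_linear \<phi>"
  obtains w where "\<And>x. inner w x = \<phi> x"
proof -
  interpret \<phi>: bounded_linear \<phi> by fact
  interpret psd_form "inner :: 'a \<Rightarrow> _" by (rule psd_form_inner)
  obtain C where C: "\<And>x. \<bar>\<phi> x\<bar> \<le> C * sqrt (inner x x)"
    using \<phi>.bounded by (auto simp: norm_eq_sqrt_inner mult.commute)
  obtain m \<delta> where \<delta>: "\<delta> \<longlonglongrightarrow> 0"
    and m: "\<And>n v. \<bar>inner (m n) v - \<phi> v\<bar> \<le> \<delta> n * sqrt (inner v v)"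
    by (rule approximate_representation[OF subspace_UNIV \<phi>.linear_axioms C]) auto
  have "Cauchy (\<lambda>n. id (m n))"
    by (rule approximate_Cauchy[OF subspace_UNIV _ \<delta> m])
      (auto simp: norm_eq_sqrt_inner intro!: linearI)
  then obtain w where w: "m \<longlonglongrightarrow> w" using Cauchy_convergent_iff convergent_def by auto
  show ?thesis
  proof
    fix x
    have "(\<lambda>n. inner (m n) x - \<phi> x) \<longlonglongrightarrow> 0"
      by (rule Lim_null_comparison[where g = "\<lambda>n. \<delta> n * sqrt (inner x x)"])
        (use m in \<open>auto intro!: tendsto_eq_intros \<delta>\<close>)
    moreover have "(\<lambda>n. inner (m n) x - \<phi> x) \<longlonglongrightarrow> inner w x - \<phi> x"
      by (intro tendsto_intros w)
    ultimately show "inner w x = \<phi> x" using LIMSEQ_unique by fastforce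
  qed
qed

lemma adjoint_exists:
  fixes B :: "'a::{real_inner,complete_space} \<Rightarrow> 'b::real_inner"
  assumes "bounded_linear B"
  obtains A where "bounded_linear A" "\<And>x y. inner (A y) x = inner y (B x)"
proof -
  interpret B: bounded_linear B by fact
  have "\<exists>w. \<forall>x. inner w x = inner y (B x)" for y
    by (rule Riesz_representation[of "\<lambda>x. inner y (B x)"])
      (auto intro: bounded_linear_inner_right_comp assms)
  then obtain A where A: "\<And>x y. inner (A y) x = inner y (B x)" by metis
  obtain K where K: "\<And>x. norm (B x) \<le> norm x * K" "K > 0" using B.pos_bounded by blast
  have "bounded_linear A"
  proof (rule bounded_linear_intro[where K = K])
    show "A (x + y) = A x + A y" for x y
      by (subst vector_eq_rdot[symmetric]) (simp add: A inner_add_left)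
    show "A (r *\<^sub>R x) = r *\<^sub>R A x" for r x
      by (subst vector_eq_rdot[symmetric]) (simp add: A)
    show "norm (A x) \<le> norm x * K" for x
    proof (cases "A x = 0")
      case False
      have "norm (A x) * norm (A x) = inner x (B (A x))"
        by (metis A dot_square_norm power2_eq_square)
      also have "\<dots> \<le> norm x * (norm (A x) * K)"
        by (meson K(1) mult_left_mono norm_cauchy_schwarz norm_ge_zero order_trans)
      finally show ?thesis using False by (simp add: mult.commute mult.left_commute)
    qed (use K in simp)
  qed
  with A show ?thesis using that by blast
qed

text \<open>Coefficient sequences become a real vector space under pointwise operations, so that
  pairs \<open>(x, p)\<close> can carry a \<open>psd_form\<close>.\<close>

instantiation "fun" :: (type, scaleR) scaleR
begin
definition scaleR_fun_def: "r *\<^sub>R f = (\<lambda>x. r *\<^sub>R f x)"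
instance ..
end

lemma scaleR_fun_apply [simp]: "(r *\<^sub>R f) x = r *\<^sub>R f x"
  by (simp add: scaleR_fun_def)

instance "fun" :: (type, real_vector) real_vector
  by standard (auto simp: fun_eq_iff scaleR_add_right scaleR_add_left)

lemma summable_inner:
  fixes f g :: "nat \<Rightarrow> 'a::real_inner"
  assumes "summable (\<lambda>k. (norm (f k))\<^sup>2)" and "summable (\<lambda>k. (norm (g k))\<^sup>2)"
  shows "summable (\<lambda>k. inner (f k) (g k))"
proof (rule summable_comparison_test'[OF summable_add[OF assms]])
  fix k
  have "\<bar>inner (f k) (g k)\<bar> \<le> norm (f k) * norm (g k)" by (rule Cauchy_Schwarz_ineq2)
  also have "\<dots> \<le> (norm (f k))\<^sup>2 + (norm (g k))\<^sup>2"
    using sum_squares_bound[of "norm (f k)" "norm (g k)"] zero_le_power2[of "norm (f k)"]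
      zero_le_power2[of "norm (g k)"] by linarith
  finally show "norm (inner (f k) (g k)) \<le> (norm (f k))\<^sup>2 + (norm (g k))\<^sup>2" by simp
qed

text \<open>The pullback of the \<open>\<ell>\<^sup>2\<close> inner product along the map with
  components \<open>A k\<close>.\<close>

lemma psd_form_suminf:
  fixes A :: "nat \<Rightarrow> 'a::real_vector \<Rightarrow> 'b::real_inner"
  assumes lin: "\<And>k. linear (A k)" and sm: "\<And>a. summable (\<lambda>k. (norm (A k a))\<^sup>2)"
  shows "psd_form (\<lambda>a b. \<Sum>k. inner (A k a) (A k b))"
proof (rule psd_form.intro)
  show "(\<Sum>k. inner (A k a) (A k b)) = (\<Sum>k. inner (A k b) (A k a))" for a b
    by (simp add: inner_commute)
  show "linear (\<lambda>a. \<Sum>k. inner (A k a) (A k b))" for b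
  proof (rule linearI)
    show "(\<Sum>k. inner (A k (a + c)) (A k b)) = (\<Sum>k. inner (A k a) (A k b)) + (\<Sum>k. inner (A k c) (A k b))"
      for a c
      by (simp add: linear_add[OF lin] inner_add_left suminf_add[symmetric] summable_inner sm)
    show "(\<Sum>k. inner (A k (r *\<^sub>R a)) (A k b)) = r *\<^sub>R (\<Sum>k. inner (A k a) (A k b))" for r a
      by (simp add: linear_scale[OF lin] suminf_mult[symmetric] summable_inner sm)
  qed
  show "0 \<le> (\<Sum>k. inner (A k a) (A k a))" for a
    by (rule suminf_nonneg) (auto intro: summable_inner sm)
qed

lemma psd_form_diff:
  assumes "psd_form Q" "psd_form R" and "\<And>a. R a a \<le> Q a a"
  shows "psd_form (\<lambda>a b. Q a b - R a b)"
proof -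
  interpret Q: psd_form Q by fact
  interpret R: psd_form R by fact
  show ?thesis
  proof (rule psd_form.intro)
    show "Q a b - R a b = Q b a - R b a" for a b using Q.sym[of a b] R.sym[of a b] by simp
    show "linear (\<lambda>a. Q a b - R a b)" for b
      by (intro linear_compose_sub Q.linear_left R.linear_left)
  qed (simp add: assms(3))
qed

section \<open>One-step extension of the interpolation data\<close>

text \<open>The construction runs over the reals; complex linearity is restored afterwards.
  \<open>dominated\<close> is the positivity of \<open>P\<close>, stated for partial sums on the
  side of \<open>N\<close>.\<close>

locale interpolation_data =
  fixes \<beta> :: "nat \<Rightarrow> real"
    and T :: "'x::real_vector \<Rightarrow> 'x"
    and E :: "'x \<Rightarrow> 'y::{real_inner,complete_space}"
    and N :: "'x \<Rightarrow> 'u::{real_inner,complete_space}"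
  assumes \<beta>_pos: "0 < \<beta> k"
    and \<beta>_dec: "decseq \<beta>"
    and T: "linear T" and E: "linear E" and N: "linear N"
    and summable_E: "summable (\<lambda>k. inverse (\<beta> k) * (norm (E ((T ^^ k) x)))\<^sup>2)"
    and dominated: "(\<Sum>j<J. (norm (N ((T ^^ j) x)))\<^sup>2) \<le> (\<Sum>k. inverse (\<beta> k) * (norm (E ((T ^^ k) x)))\<^sup>2)"
begin

lemma \<beta>_nz [simp]: "\<beta> k \<noteq> 0"
  using \<beta>_pos[of k] by simp

lemma \<beta>_nonneg [simp]: "0 \<le> \<beta> k"
  using \<beta>_pos[of k] by simp

lemma T_pow: "linear (T ^^ k)"
  by (induction k) (auto intro: linear_compose T simp: linear_iff linear_add[OF T] linear_scale[OF T])

text \<open>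
  A pair \<open>(x, p)\<close> encodes the power series \<open>\<O>\<^sub>\<beta> x + p\<close>, where \<open>p\<close> is cut off to a polynomial of degree
  less than \<open>n\<close>. The \<open>\<ell>\<^sup>2\<close> norm of \<open>Phi n a\<close> is its norm in the weighted Hardy space.
\<close>

definition Phi :: "nat \<Rightarrow> 'x \<times> (nat \<Rightarrow> 'y) \<Rightarrow> nat \<Rightarrow> 'y" where
  "Phi n a k = sqrt (\<beta> k) *\<^sub>R (inverse (\<beta> k) *\<^sub>R E ((T ^^ k) (fst a)) + (if k < n then snd a k else 0))"

text \<open>
  The coefficients of the image of \<open>(x, p)\<close> under the operator that is to become \<open>M\<^sub>S\<^sup>*\<close>. It intertwines
  the backward shifts, hence is determined by the operators \<open>B k\<close> giving the constant
  coefficients of the images of \<open>z\<^sup>k y\<close>.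
\<close>

definition G :: "nat \<Rightarrow> (nat \<Rightarrow> 'y \<Rightarrow> 'u) \<Rightarrow> nat \<Rightarrow> 'x \<times> (nat \<Rightarrow> 'y) \<Rightarrow> 'u" where
  "G n B j a = N ((T ^^ j) (fst a)) + (\<Sum>k<n - j. (\<beta> (k + j) / \<beta> k) *\<^sub>R B k (snd a (k + j)))"

text \<open>Contractivity of the extension to degrees less than \<open>n\<close>; bounding all
  partial sums over \<open>j\<close> includes the square summability of the image.\<close>

definition admissible :: "nat \<Rightarrow> (nat \<Rightarrow> 'y \<Rightarrow> 'u) \<Rightarrow> bool" where
  "admissible n B \<longleftrightarrow> (\<forall>k<n. linear (B k)) \<and>
     (\<forall>a J. (\<Sum>j<J. (norm (G n B j a))\<^sup>2) \<le> (\<Sum>k. (norm (Phi n a k))\<^sup>2))"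

text \<open>The adjoint of multiplication by \<open>z\<close> in the weighted space. It sends the
  observability series of \<open>x\<close> to that of \<open>T x\<close>, and the polynomial
  coefficients pick up the ratio of consecutive weights.\<close>

definition backward_shift :: "'x \<times> (nat \<Rightarrow> 'y) \<Rightarrow> 'x \<times> (nat \<Rightarrow> 'y)" where
  "backward_shift a = (T (fst a), \<lambda>k. (\<beta> (Suc k) / \<beta> k) *\<^sub>R snd a (Suc k))"

lemma linear_Phi: "linear (\<lambda>a. Phi n a k)"
  by (rule linearI) (auto simp: Phi_def linear_add[OF T_pow] linear_add[OF E] linear_scale[OF T_pow]
      linear_scale[OF E] algebra_simps)

lemma linear_G:
  assumes "\<And>k. k < n \<Longrightarrow> linear (B k)"
  shows "linear (G n B j)"
proof (rule linearI)
  show "G n B j (a + b) = G n B j a + G n B j b" for a b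
    using assms by (simp add: G_def linear_add[OF T_pow] linear_add[OF N] linear_add
        scaleR_add_right sum.distrib)
  show "G n B j (r *\<^sub>R a) = r *\<^sub>R G n B j a" for r a
    using assms by (simp add: G_def linear_scale[OF T_pow] linear_scale[OF N] linear_scale
        scaleR_add_right scaleR_sum_right mult.commute)
qed

text \<open>The polynomial part changes only the terms with \<open>k < n\<close>.\<close>

lemma summable_Phi: "summable (\<lambda>k. (norm (Phi n a k))\<^sup>2)"
proof -
  have "summable (\<lambda>k. inverse (\<beta> k) * (norm (E ((T ^^ k) (fst a))))\<^sup>2) \<longleftrightarrow>
    summable (\<lambda>k. (norm (Phi n a k))\<^sup>2)"
  proof (rule summable_cong)
    show "\<forall>\<^sub>F k in sequentially. inverse (\<beta> k) * (norm (E ((T ^^ k) (fst a))))\<^sup>2 = (norm (Phi n a k))\<^sup>2"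
      using eventually_ge_at_top[of n]
      by eventually_elim (simp add: Phi_def power_mult_distrib power2_eq_square field_simps)
  qed
  with summable_E show ?thesis by blast
qed

text \<open>The two sides differ by the factor \<open>\<beta> (Suc k) / \<beta> k\<close>, which is
  at most 1 because the weights do not increase.\<close>

lemma norm_Phi_shift: "(norm (Phi n (backward_shift a) k))\<^sup>2 \<le> (norm (Phi (Suc n) a (Suc k)))\<^sup>2"
proof -
  have "Phi n (backward_shift a) k = (sqrt (\<beta> k) * \<beta> (Suc k) / \<beta> k) *\<^sub>R
      (inverse (\<beta> (Suc k)) *\<^sub>R E ((T ^^ Suc k) (fst a)) + (if k < n then snd a (Suc k) else 0))"
    by (simp add: Phi_def backward_shift_def funpow_swap1 scaleR_add_right divide_simps)
  also have "norm \<dots> = (sqrt (\<beta> k) * \<beta> (Suc k) / \<beta> k / sqrt (\<beta> (Suc k))) * norm (Phi (Suc n) a (Suc k))"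
    by (simp add: Phi_def)
  finally have "(norm (Phi n (backward_shift a) k))\<^sup>2 =
      (\<beta> (Suc k) / \<beta> k) * (norm (Phi (Suc n) a (Suc k)))\<^sup>2"
    by (simp add: power_mult_distrib power_divide) (simp add: power2_eq_square)
  also have "\<dots> \<le> 1 * (norm (Phi (Suc n) a (Suc k)))\<^sup>2"
    using decseq_SucD[OF \<beta>_dec, of k] \<beta>_pos[of k] by (intro mult_right_mono) auto
  finally show ?thesis by simp
qed

lemma suminf_Phi_shift:
  "(\<Sum>k. (norm (Phi n (backward_shift a) k))\<^sup>2) \<le> (\<Sum>k. (norm (Phi (Suc n) a k))\<^sup>2)"
proof -
  have "(\<Sum>k. (norm (Phi n (backward_shift a) k))\<^sup>2) \<le> (\<Sum>k. (norm (Phi (Suc n) a (Suc k)))\<^sup>2)"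
    using summable_Phi[of n "backward_shift a"] summable_Phi[of "Suc n" a]
    by (intro suminf_le norm_Phi_shift) (simp_all add: summable_Suc_iff[of "\<lambda>k. (norm (Phi (Suc n) a k))\<^sup>2"])
  also have "\<dots> \<le> (\<Sum>k. (norm (Phi (Suc n) a k))\<^sup>2)"
    using suminf_split_head[OF summable_Phi, of "Suc n" a] by simp
  finally show ?thesis .
qed

text \<open>The intertwining relation: the weight ratios telescope,
  \<open>\<beta> (k + j + 1) / \<beta> (k + j)\<close> times
  \<open>\<beta> (k + j) / \<beta> k\<close>. So every coefficient but the constant one comes from
  the previous level.\<close>

lemma G_shift:
  assumes "\<And>k. k < n \<Longrightarrow> linear (B k)"
  shows "G (Suc n) B (Suc j) a = G n B j (backward_shift a)"
  using assms by (simp add: G_def backward_shift_def funpow_swap1 linear_scale)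

lemma G_cong: "(\<And>k. k < n - j \<Longrightarrow> B k = B' k) \<Longrightarrow> G n B j a = G n B' j a"
  by (simp add: G_def)

lemma admissible_0: "admissible 0 B"
proof -
  have "(norm (Phi 0 a k))\<^sup>2 = inverse (\<beta> k) * (norm (E ((T ^^ k) (fst a))))\<^sup>2" for a k
    by (simp add: Phi_def power_mult_distrib power2_eq_square field_simps)
  then show ?thesis by (simp add: admissible_def G_def dominated)
qed

text \<open>Only the constant coefficient involves the new operator \<open>b\<close>. Its required
  bound is the defect form \<open>Q\<close>, which is positive semidefinite by the level
  \<open>n\<close> bound at the shifted vector; \<open>contraction_extension\<close> then yields
  \<open>b\<close> from the values on degrees less than \<open>n\<close>.\<close>

lemma admissible_Suc:
  assumes B: "admissible n B"
  obtains b where "admissible (Suc n) (B(n := b))"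
proof -
  have lin: "linear (B k)" if "k < n" for k using B that by (simp add: admissible_def)
  have le: "(\<Sum>j<J. (norm (G n B j a))\<^sup>2) \<le> (\<Sum>k. (norm (Phi n a k))\<^sup>2)" for a J
    using B unfolding admissible_def by blast
  define tail where "tail a j = G (Suc n) B (Suc j) a" for a j
  have tail_shift: "tail a j = G n B j (backward_shift a)" for a j
    unfolding tail_def by (rule G_shift) (rule lin)
  \<comment> \<open>\<open>B n\<close> is still arbitrary, perhaps nonlinear; the tail does not see
    it, so it may be replaced by zero.\<close>
  have linear_tail: "linear (\<lambda>a. tail a j)" for j
  proof -
    have "tail a j = G (Suc n) (B(n := \<lambda>_. 0)) (Suc j) a" for a
      unfolding tail_def by (rule G_cong) auto
    moreover have "linear (G (Suc n) (B(n := \<lambda>_. 0)) (Suc j))"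
      by (rule linear_G) (auto simp: less_Suc_eq lin linear_zero)
    ultimately show ?thesis by presburger
  qed
  have tail_le: "(\<Sum>j<J. (norm (tail a j))\<^sup>2) \<le> (\<Sum>k. (norm (Phi (Suc n) a k))\<^sup>2)" for a J
    unfolding tail_shift using le suminf_Phi_shift by (rule order_trans)
  have summable_tail: "summable (\<lambda>j. (norm (tail a j))\<^sup>2)" for a
    by (rule summableI_nonneg_bounded[OF _ tail_le]) simp
  define Q where "Q a b = (\<Sum>k. inner (Phi (Suc n) a k) (Phi (Suc n) b k)) - (\<Sum>j. inner (tail a j) (tail b j))"
    for a b
  have Q_same: "Q a a = (\<Sum>k. (norm (Phi (Suc n) a k))\<^sup>2) - (\<Sum>j. (norm (tail a j))\<^sup>2)" for a
    by (simp add: Q_def power2_norm_eq_inner)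
  interpret psd_form Q unfolding Q_def
  proof (intro psd_form_diff psd_form_suminf linear_Phi linear_tail summable_Phi summable_tail)
    show "(\<Sum>j. inner (tail a j) (tail a j)) \<le> (\<Sum>k. inner (Phi (Suc n) a k) (Phi (Suc n) a k))" for a
      using suminf_le_const[OF summable_tail tail_le] by (simp add: power2_norm_eq_inner)
  qed
  \<comment> \<open>Entries beyond \<open>n\<close> are cut off anyway, so on \<open>W\<close> level
    \<open>Suc n\<close> reduces to level \<open>n\<close>.\<close>
  define W :: "('x \<times> (nat \<Rightarrow> 'y)) set" where "W = {a. snd a n = 0}"
  have "subspace W" by (auto simp: W_def subspace_def)
  moreover have "linear (G n B 0)" by (rule linear_G) (rule lin)
  moreover have "norm (G n B 0 a) \<le> sqrt (Q a a)" if "a \<in> W" for a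
  proof (rule real_le_rsqrt)
    have a: "snd a n = 0" using that by (simp add: W_def)
    have Phi: "Phi (Suc n) a k = Phi n a k" for k
      using a by (cases "k = n") (auto simp: Phi_def)
    \<comment> \<open>For \<open>j < n\<close> the left side has one extra summand,
      \<open>k = n - Suc j\<close>, and it contains \<open>snd a n = 0\<close>.\<close>
    have tail: "tail a j = G n B (Suc j) a" for j
    proof (cases "j < n")
      case True
      then have "n - j = Suc (n - Suc j)" by simp
      then show ?thesis using a True by (simp add: tail_def G_def linear_0[OF lin])
    qed (simp add: tail_def G_def)
    have "(\<Sum>j<J. (norm (tail a j))\<^sup>2) \<le> (\<Sum>k. (norm (Phi (Suc n) a k))\<^sup>2) - (norm (G n B 0 a))\<^sup>2" for J
      using le[where J = "Suc J" and a = a] by (simp add: Phi tail sum.lessThan_Suc_shift del: sum.lessThan_Suc)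
    from suminf_le_const[OF summable_tail this] show "(norm (G n B 0 a))\<^sup>2 \<le> Q a a"
      by (simp add: Q_same)
  qed
  ultimately obtain L where L: "linear L" "\<And>a. a \<in> W \<Longrightarrow> L a = G n B 0 a"
    and L_le: "\<And>a. norm (L a) \<le> sqrt (Q a a)"
    using contraction_extension by blast
  define single :: "'y \<Rightarrow> 'x \<times> (nat \<Rightarrow> 'y)" where "single y = (0, \<lambda>k. if k = n then y else 0)" for y
  define b where "b y = L (single y)" for y
  have single: "linear single" by (rule linearI) (auto simp: single_def fun_eq_iff zero_prod_def)
  have b: "linear b" unfolding b_def using linear_compose[OF single L(1)] by (simp add: o_def)
  have G_0: "G (Suc n) (B(n := b)) 0 a = L a" for a
  proof -
    \<comment> \<open>Splitting off the monomial of degree \<open>n\<close> leaves an element of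
      \<open>W\<close>, where \<open>L\<close> is known.\<close>
    define a' where "a' = (fst a, (snd a)(n := 0))"
    have "a = a' + single (snd a n)"
      by (auto simp: a'_def single_def prod_eq_iff fun_eq_iff)
    then have "L a = L a' + b (snd a n)" by (metis L(1) b_def linear_add)
    also have "L a' = G n B 0 a'" by (rule L) (simp add: W_def a'_def)
    also have "\<dots> + b (snd a n) = G (Suc n) (B(n := b)) 0 a" by (simp add: G_def a'_def)
    finally show ?thesis by simp
  qed
  have G_Suc: "G (Suc n) (B(n := b)) (Suc j) a = tail a j" for j a
    unfolding tail_def by (rule G_cong) auto
  have "admissible (Suc n) (B(n := b))" unfolding admissible_def
  proof (intro conjI allI impI)
    show "linear ((B(n := b)) k)" if "k < Suc n" for k using that lin b by (auto simp: less_Suc_eq)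
    show "(\<Sum>j<J. (norm (G (Suc n) (B(n := b)) j a))\<^sup>2) \<le> (\<Sum>k. (norm (Phi (Suc n) a k))\<^sup>2)" for a J
    proof (cases J)
      case 0
      then show ?thesis by (simp add: suminf_nonneg summable_Phi)
    next
      case (Suc J')
      have "(norm (L a))\<^sup>2 \<le> Q a a" using L_le[of a] nonneg[of a] by (simp add: sqrt_ge_absD)
      moreover have "(\<Sum>j<J'. (norm (tail a j))\<^sup>2) \<le> (\<Sum>j. (norm (tail a j))\<^sup>2)"
        by (rule sum_le_suminf[OF summable_tail]) auto
      ultimately show ?thesis
        by (simp add: Suc sum.lessThan_Suc_shift G_0 G_Suc Q_same del: sum.lessThan_Suc)
    qed
  qed
  then show ?thesis by (rule that)
qed

lemma admissible_cong: "(\<And>k. k < n \<Longrightarrow> B k = B' k) \<Longrightarrow> admissible n B \<longleftrightarrow> admissible n B'"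
  using G_cong[of n _ B B'] by (simp add: admissible_def)

text \<open>Stage \<open>n\<close> alters only the entry \<open>n\<close>, so entry \<open>k\<close>
  is frozen from stage \<open>Suc k\<close> on and the diagonal agrees with each stage below its
  level.\<close>

lemma admissible_sequence:
  obtains B where "\<And>n. admissible n B"
proof -
  have "\<exists>f. \<forall>n. admissible n (f n) \<and> (\<exists>b. f (Suc n) = (f n)(n := b))"
    by (rule dependent_nat_choice) (use admissible_0 admissible_Suc in metis)+
  then obtain f where f: "\<And>n. admissible n (f n)" "\<And>n. \<exists>b. f (Suc n) = (f n)(n := b)" by blast
  define B where "B k = f (Suc k) k" for k
  have "B k = f n k" if "k < n" for n k
    using that
  proof (induction n)
    case (Suc n)
    then show ?case using f(2)[of n] by (cases "k = n") (auto simp: B_def)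
  qed simp
  then have "admissible n B" for n using f(1)[of n] admissible_cong[of n B "f n"] by simp
  then show ?thesis by (rule that)
qed

text \<open>\<open>S k\<close> is the coefficient of \<open>z\<^sup>k\<close> in the multiplier. As
  \<open>B k y\<close> is the constant coefficient of the adjoint at \<open>z\<^sup>k y\<close>, it
  must satisfy \<open>\<beta> k * inner (S k u) y = inner u (B k y)\<close>.\<close>

lemma real_multiplier:
  obtains S :: "nat \<Rightarrow> 'u \<Rightarrow> 'y"
  where "\<And>k. bounded_linear (S k)"
    and "\<And>f n. (\<Sum>m<n. \<beta> m * (norm (\<Sum>j\<le>m. S (m - j) (f j)))\<^sup>2) \<le> (\<Sum>j<n. (norm (f j))\<^sup>2)"
    and "\<And>u x. (\<lambda>k. inner (S k u) (E ((T ^^ k) x))) sums inner u (N x)"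
proof -
  obtain B where B: "\<And>n. admissible n B" by (rule admissible_sequence) blast
  have lin: "linear (B k)" for k using B[of "Suc k"] by (simp add: admissible_def)
  have le: "(\<Sum>j<J. (norm (G n B j a))\<^sup>2) \<le> (\<Sum>k. (norm (Phi n a k))\<^sup>2)" for a J n
    using B unfolding admissible_def by blast
  have Phi_poly: "(\<Sum>k. (norm (Phi n (0, p) k))\<^sup>2) = (\<Sum>k<n. \<beta> k * (norm (p k))\<^sup>2)" for n p
  proof -
    have "(\<Sum>k. (norm (Phi n (0, p) k))\<^sup>2) = (\<Sum>k<n. (norm (Phi n (0, p) k))\<^sup>2)"
      by (rule suminf_finite) (auto simp: Phi_def linear_0[OF T_pow] linear_0[OF E])
    also have "\<dots> = (\<Sum>k<n. \<beta> k * (norm (p k))\<^sup>2)"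
      by (auto simp: Phi_def linear_0[OF T_pow] linear_0[OF E] power_mult_distrib intro!: sum.cong)
    finally show ?thesis .
  qed
  have bounded_B: "bounded_linear (B k)" for k
  proof (rule bounded_linear_intro[where K = "sqrt (\<beta> k)"])
    fix y :: 'y
    \<comment> \<open>The monomial \<open>z\<^sup>k y\<close> has norm
      \<open>sqrt (\<beta> k) * norm y\<close>, which bounds its constant coefficient
      \<open>B k y\<close> (\<open>J = 1\<close>).\<close>
    define p where "p i = (if i = k then y else 0)" for i
    have "(norm (B k y))\<^sup>2 = (norm (G (Suc k) B 0 (0, p)))\<^sup>2"
      by (simp add: G_def p_def linear_0[OF lin] linear_0[OF N])
    also have "\<dots> \<le> \<beta> k * (norm y)\<^sup>2"
      using le[where J = 1 and n = "Suc k" and a = "(0, p)"] unfolding Phi_poly by (simp add: p_def)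
    also have "\<dots> = (norm y * sqrt (\<beta> k))\<^sup>2" by (simp add: power_mult_distrib)
    finally show "norm (B k y) \<le> norm y * sqrt (\<beta> k)" by (rule power2_le_imp_le) simp
  qed (simp_all add: linear_add[OF lin] linear_scale[OF lin])
  have "\<exists>A. bounded_linear A \<and> (\<forall>y u. inner (A u) y = inner u (B k y))" for k
    using adjoint_exists[OF bounded_B] by metis
  then obtain A where A: "\<And>k. bounded_linear (A k)" "\<And>k y u. inner (A k u) y = inner u (B k y)"
    by metis
  define S where "S k u = inverse (\<beta> k) *\<^sub>R A k u" for k u
  have S: "inner (S k u) y = inverse (\<beta> k) * inner u (B k y)" for k u y by (simp add: S_def A)
  show ?thesis
  proof
    show "bounded_linear (S k)" for k
      unfolding S_def using A(1) by (rule bounded_linear_const_scaleR)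
    show "(\<Sum>m<n. \<beta> m * (norm (\<Sum>j\<le>m. S (m - j) (f j)))\<^sup>2) \<le> (\<Sum>j<n. (norm (f j))\<^sup>2)" for f n
    proof -
      \<comment> \<open>Duality: testing on the truncated product itself gives
        \<open>D = (\<Sum>j<n. inner (f j) (G n B j (0, p)))\<close>. Admissibility bounds the
        squared norm of the \<open>G\<close> part by \<open>D\<close>, so \<open>D\<close> is at
        most half of \<open>(\<Sum>j<n. (norm (f j))\<^sup>2) + D\<close>, and \<open>D\<close> can
        be absorbed.\<close>
      define p where "p m = (\<Sum>j\<le>m. S (m - j) (f j))" for m
      define g where "g j k = inner (f j) ((\<beta> (k + j) / \<beta> k) *\<^sub>R B k (p (k + j)))" for j k
      define D where "D = (\<Sum>m<n. \<beta> m * (norm (p m))\<^sup>2)"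
      have "D = (\<Sum>m<n. \<Sum>j\<le>m. g j (m - j))"
        unfolding D_def
      proof (intro sum.cong refl)
        fix m
        have "\<beta> m * (norm (p m))\<^sup>2 = \<beta> m * inner (\<Sum>j\<le>m. S (m - j) (f j)) (p m)"
          by (simp add: power2_norm_eq_inner p_def)
        also have "\<dots> = (\<Sum>j\<le>m. g j (m - j))"
          by (simp add: inner_sum_left sum_distrib_left g_def S divide_inverse mult.assoc)
        finally show "\<beta> m * (norm (p m))\<^sup>2 = (\<Sum>j\<le>m. g j (m - j))" .
      qed
      also have "\<dots> = (\<Sum>(j, k)\<in>{(j, k). j + k < n}. g j k)"
        by (rule sum.triangle_reindex[symmetric])
      also have "{(j, k). j + k < n} = Sigma {..<n} (\<lambda>j. {..<n - j})" by auto
      also have "(\<Sum>(j, k)\<in>\<dots>. g j k) = (\<Sum>j<n. \<Sum>k<n - j. g j k)"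
        by (rule sum.Sigma[symmetric]) auto
      also have "\<dots> = (\<Sum>j<n. inner (f j) (G n B j (0, p)))"
        by (simp add: g_def G_def linear_0[OF T_pow] linear_0[OF N] inner_sum_right)
      also have "\<dots> \<le> (\<Sum>j<n. ((norm (f j))\<^sup>2 + (norm (G n B j (0, p)))\<^sup>2) / 2)"
      proof (rule sum_mono)
        fix j
        show "inner (f j) (G n B j (0, p)) \<le> ((norm (f j))\<^sup>2 + (norm (G n B j (0, p)))\<^sup>2) / 2"
          using norm_cauchy_schwarz[of "f j" "G n B j (0, p)"]
            sum_squares_bound[of "norm (f j)" "norm (G n B j (0, p))"] by simp
      qed
      also have "\<dots> = ((\<Sum>j<n. (norm (f j))\<^sup>2) + (\<Sum>j<n. (norm (G n B j (0, p)))\<^sup>2)) / 2"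
        by (simp add: sum.distrib sum_divide_distrib[symmetric])
      finally show ?thesis
        using le[where J = n and n = n and a = "(0, p)"] unfolding Phi_poly D_def[symmetric] p_def[symmetric] by simp
    qed
    show "(\<lambda>k. inner (S k u) (E ((T ^^ k) x))) sums inner u (N x)" for u x
    proof -
      define h where "h k = inverse (\<beta> k) * (norm (E ((T ^^ k) x)))\<^sup>2" for k
      \<comment> \<open>This \<open>p\<close> cancels the first \<open>n\<close> coefficients of the
        observability series. The remainder tends to 0 in norm, hence so does the constant
        coefficient of its image, which is \<open>N x\<close> minus a partial sum.\<close>
      define p where "p k = - inverse (\<beta> k) *\<^sub>R E ((T ^^ k) x)" for k
      have G: "G n B 0 (x, p) = N x - (\<Sum>k<n. inverse (\<beta> k) *\<^sub>R B k (E ((T ^^ k) x)))" for n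
        by (simp add: G_def p_def linear_scale[OF lin] sum_negf linear_neg[OF lin])
      have Phi: "(\<Sum>k. (norm (Phi n (x, p) k))\<^sup>2) = suminf h - (\<Sum>k<n. h k)" for n
      proof -
        have "(norm (Phi n (x, p) k))\<^sup>2 = h k - (if k < n then h k else 0)" for k
          by (simp add: Phi_def p_def h_def power_mult_distrib power2_eq_square field_simps)
        moreover have "(\<lambda>k. h k - (if k < n then h k else 0)) sums (suminf h - (\<Sum>k\<in>{k. k < n}. h k))"
          by (intro sums_diff summable_sums sums_If_finite) (auto simp: h_def summable_E)
        ultimately show ?thesis by (simp add: sums_iff lessThan_def)
      qed
      have "(\<lambda>n. sqrt (suminf h - (\<Sum>k<n. h k))) \<longlonglongrightarrow> sqrt (suminf h - suminf h)"
        by (intro tendsto_intros summable_LIMSEQ) (simp add: h_def summable_E)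
      moreover have "norm (G n B 0 (x, p)) \<le> sqrt (suminf h - (\<Sum>k<n. h k))" for n
        using le[where J = 1 and n = n and a = "(x, p)"] by (intro real_le_rsqrt) (simp add: Phi)
      ultimately have "(\<lambda>n. G n B 0 (x, p)) \<longlonglongrightarrow> 0"
        by - (rule Lim_null_comparison[where g = "\<lambda>n. sqrt (suminf h - (\<Sum>k<n. h k))"], auto)
      then have "(\<lambda>n. inner u (N x) - inner u (G n B 0 (x, p))) \<longlonglongrightarrow> inner u (N x) - inner u 0"
        by (intro tendsto_intros)
      moreover have "inner u (N x) - inner u (G n B 0 (x, p)) = (\<Sum>k<n. inner (S k u) (E ((T ^^ k) x)))" for n
        by (simp add: G inner_diff_right inner_sum_right S)
      ultimately show ?thesis by (simp add: sums_def)
    qed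
  qed
qed

end

section \<open>Complex Hilbert spaces and weighted Hardy spaces\<close>

lemma cinner_add_right: "cinner x (y + z) = cinner x y + cinner x z"
  by (metis cinner_add_left cinner_commute complex_cnj_add)

lemma cinner_scaleC_right: "cinner x (c *\<^sub>C y) = cnj c * cinner x y"
  by (metis cinner_commute cinner_scaleC_left complex_cnj_mult)

lemma scaleR_scaleC: "r *\<^sub>R x = complex_of_real r *\<^sub>C x"
  by (simp add: scaleC_of_real)

lemma cinner_scaleR_left: "cinner (r *\<^sub>R x) y = r *\<^sub>R cinner x y"
  and cinner_scaleR_right: "cinner x (r *\<^sub>R y) = r *\<^sub>R cinner x y"
  using cinner_scaleC_left[of "complex_of_real r" x y] cinner_scaleC_right[of x "complex_of_real r" y]
  by (simp_all add: scaleC_of_real scaleR_conv_of_real)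

lemma Im_cinner: "Im (cinner x y) = inner x (\<i> *\<^sub>C y)"
  by (simp add: Re_cinner[symmetric] cinner_scaleC_right)

lemma cinner_self: "cinner x x = complex_of_real ((norm x)\<^sup>2)"
proof (rule complex_eqI)
  show "Im (cinner x x) = Im (complex_of_real ((norm x)\<^sup>2))"
    using arg_cong[OF cinner_commute[of x x], of Im] by simp
qed (simp add: Re_cinner power2_norm_eq_inner)

lemma norm_scaleC: "norm (c *\<^sub>C x) = cmod c * norm x"
proof (rule power2_eq_imp_eq)
  have "complex_of_real ((norm (c *\<^sub>C x))\<^sup>2) = complex_of_real ((cmod c * norm x)\<^sup>2)"
    unfolding cinner_self[symmetric] cinner_scaleC_left cinner_scaleC_right
    by (simp add: cinner_self complex_norm_square power_mult_distrib mult.assoc[symmetric] del: of_real_power)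
  then show "(norm (c *\<^sub>C x))\<^sup>2 = (cmod c * norm x)\<^sup>2" unfolding of_real_eq_iff .
qed auto

text \<open>Multiplying \<open>x\<close> by the conjugate \<open>w\<close> of the inner product
  makes it real, so the real Cauchy-Schwarz inequality applies; one factor \<open>cmod w\<close>
  cancels.\<close>

lemma cinner_norm_bound: "cmod (cinner x y) \<le> norm x * norm y"
proof (cases "cinner x y = 0")
  case False
  define w where "w = cnj (cinner x y)"
  have "complex_of_real ((cmod w)\<^sup>2) = cinner (w *\<^sub>C x) y"
    unfolding complex_norm_square by (simp add: w_def cinner_scaleC_left)
  then have "(cmod w)\<^sup>2 = inner (w *\<^sub>C x) y" by (metis Re_cinner Re_complex_of_real)
  also have "\<dots> \<le> cmod w * norm x * norm y" using norm_cauchy_schwarz[of "w *\<^sub>C x" y] by (simp add: norm_scaleC)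
  finally show ?thesis using False by (simp add: w_def power2_eq_square)
qed simp

lemma bounded_bilinear_cinner: "bounded_bilinear cinner"
  by (rule bounded_bilinear.intro)
    (auto simp: cinner_add_left cinner_add_right cinner_scaleR_left cinner_scaleR_right
      intro!: exI[of _ 1] cinner_norm_bound)

lemma bounded_bilinear_scaleC: "bounded_bilinear scaleC"
proof (rule bounded_bilinear.intro)
  show "(r *\<^sub>R c) *\<^sub>C x = r *\<^sub>R (c *\<^sub>C x)" "c *\<^sub>C r *\<^sub>R x = r *\<^sub>R (c *\<^sub>C x)" for r c and x :: 'a
    by (simp_all add: scaleR_scaleC[of r] scaleC_scaleC scaleR_conv_of_real mult.commute)
qed (auto simp: scaleC_add_left scaleC_add_right norm_scaleC intro!: exI[of _ 1])

interpretation cinner: bounded_bilinear cinner by (rule bounded_bilinear_cinner)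
interpretation scaleC: bounded_bilinear scaleC by (rule bounded_bilinear_scaleC)

lemma cinner_left_ext: "(\<And>x. cinner w x = cinner v x) \<Longrightarrow> w = v"
  by (metis Re_cinner vector_eq_rdot)

lemma scaleC_one: "1 *\<^sub>C x = x"
  using scaleC_of_real[of 1 x] by simp

lemma cinner_eq: "cinner x y = Complex (inner x y) (inner x (\<i> *\<^sub>C y))"
  by (simp add: complex_eq_iff Re_cinner Im_cinner)

lemma scaleC_ii: "\<i> *\<^sub>C \<i> *\<^sub>C x = - x"
  using scaleC_of_real[of "-1" x] by (simp add: scaleC_scaleC)

lemma inner_ii_left: "inner (\<i> *\<^sub>C x) y = - inner x (\<i> *\<^sub>C y)"
  by (simp add: Re_cinner[symmetric] cinner_scaleC_left cinner_scaleC_right)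

text \<open>Real Riesz representation of \<open>Re (\<phi> x)\<close>; the imaginary part is the
  real part at \<open>\<i> *\<^sub>C x\<close>, by antilinearity.\<close>

lemma clinear_Riesz:
  fixes \<phi> :: "'a::complex_hilbert_space \<Rightarrow> complex"
  assumes add: "\<And>x y. \<phi> (x + y) = \<phi> x + \<phi> y" and scale: "\<And>c x. \<phi> (c *\<^sub>C x) = cnj c * \<phi> x"
    and bound: "\<And>x. cmod (\<phi> x) \<le> K * norm x"
  obtains w where "\<And>x. cinner w x = \<phi> x"
proof -
  have "bounded_linear (\<lambda>x. Re (\<phi> x))"
  proof (rule bounded_linear_intro[where K = K])
    show "norm (Re (\<phi> x)) \<le> norm x * K" for x
      using abs_Re_le_cmod[of "\<phi> x"] bound[of x] by (simp add: mult.commute)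
  qed (simp_all add: add scaleR_scaleC scale)
  then obtain w where w: "\<And>x. inner w x = Re (\<phi> x)" using Riesz_representation by blast
  have "cinner w x = \<phi> x" for x by (simp add: cinner_eq w scale complex_eq_iff)
  then show ?thesis by (rule that)
qed

text \<open>The assumptions make \<open>ip h (A x)\<close> a bounded antilinear functional of
  \<open>x\<close>, so the description in \<open>hadjoint\<close> has exactly one solution.\<close>

lemma cinner_hadjoint:
  fixes A :: "'a::complex_hilbert_space \<Rightarrow> 'h"
  assumes "\<And>x y. ip h (A (x + y)) = ip h (A x) + ip h (A y)"
    and "\<And>c x. ip h (A (c *\<^sub>C x)) = cnj c * ip h (A x)"
    and "\<And>x. cmod (ip h (A x)) \<le> K * norm x"
  shows "cinner (hadjoint ip A h) x = ip h (A x)"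
proof -
  obtain w where w: "\<And>x. cinner w x = ip h (A x)"
    by (rule clinear_Riesz[of "\<lambda>x. ip h (A x)", OF assms]) (rule that)
  have "hadjoint ip A h = w" unfolding hadjoint_def
  proof (rule the_equality)
    show "v = w" if "\<forall>x. cinner v x = ip h (A x)" for v
      by (rule cinner_left_ext) (simp only: that w)
  qed (simp add: w)
  then show ?thesis by (simp only: w)
qed

lemma bounded_clinear_simps:
  assumes "bounded_clinear A"
  shows "A (x + y) = A x + A y" "A (c *\<^sub>C x) = c *\<^sub>C A x" "A (r *\<^sub>R x) = r *\<^sub>R A x" "A 0 = 0"
    "linear A" "bounded_linear A"
  using assms by (auto simp: bounded_clinear_def linear_simps bounded_linear.linear)

lemma bounded_clinear_pow:
  fixes T :: "'a::complex_hilbert_space \<Rightarrow> 'a"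
  assumes "bounded_clinear T"
  shows "bounded_clinear (T ^^ k)"
proof (induction k)
  case 0
  have "T ^^ 0 = (\<lambda>x. x)" by (rule ext) simp
  then show ?case by (simp only: bounded_clinear_def bounded_linear_ident) simp
next
  case (Suc k)
  then show ?case using assms
    by (auto simp: bounded_clinear_def o_def intro: bounded_linear_compose)
qed

section \<open>Inner product and power series of the weighted Hardy space\<close>

lemma H2_cinner_summable_norm:
  assumes \<beta>: "\<And>k. 0 \<le> \<beta> k" and f: "f \<in> H2 \<beta>" and g: "g \<in> H2 \<beta>"
  shows "summable (\<lambda>k. norm (complex_of_real (\<beta> k) * cinner (f k) (g k)))"
    and "(\<Sum>k. norm (complex_of_real (\<beta> k) * cinner (f k) (g k))) \<le> H2_norm \<beta> f * H2_norm \<beta> g"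
proof -
  define t where "t k = norm (complex_of_real (\<beta> k) * cinner (f k) (g k))" for k
  have L2: "L2_set (\<lambda>k. sqrt (\<beta> k) * norm (h k)) {..<n} \<le> H2_norm \<beta> h" if "h \<in> H2 \<beta>"
    for h :: "nat \<Rightarrow> 'a" and n
  proof -
    have "(\<Sum>k<n. \<beta> k * (norm (h k))\<^sup>2) \<le> (\<Sum>k. \<beta> k * (norm (h k))\<^sup>2)"
      using that \<beta> by (intro sum_le_suminf) (auto simp: H2_def)
    then show ?thesis using \<beta> by (simp add: L2_set_def H2_norm_def power_mult_distrib)
  qed
  have bound: "(\<Sum>k<n. t k) \<le> H2_norm \<beta> f * H2_norm \<beta> g" for n
  proof -
    \<comment> \<open>The weight is shared as \<open>sqrt (\<beta> k)\<close> between both factors,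
      ready for the finite Cauchy-Schwarz inequality.\<close>
    have "(\<Sum>k<n. t k) \<le> (\<Sum>k<n. \<bar>sqrt (\<beta> k) * norm (f k)\<bar> * \<bar>sqrt (\<beta> k) * norm (g k)\<bar>)"
    proof (rule sum_mono)
      fix k
      have "t k \<le> \<beta> k * (norm (f k) * norm (g k))"
        using \<beta> by (simp add: t_def norm_mult mult_left_mono cinner_norm_bound)
      also have "\<dots> = (sqrt (\<beta> k) * sqrt (\<beta> k)) * (norm (f k) * norm (g k))" using \<beta> by simp
      finally have "t k \<le> (sqrt (\<beta> k) * norm (f k)) * (sqrt (\<beta> k) * norm (g k))"
        by (simp only: mult_ac)
      then show "t k \<le> \<bar>sqrt (\<beta> k) * norm (f k)\<bar> * \<bar>sqrt (\<beta> k) * norm (g k)\<bar>"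
        using \<beta> by (simp add: abs_mult)
    qed
    also have "\<dots> \<le> L2_set (\<lambda>k. sqrt (\<beta> k) * norm (f k)) {..<n} * L2_set (\<lambda>k. sqrt (\<beta> k) * norm (g k)) {..<n}"
      by (rule L2_set_mult_ineq)
    also have "\<dots> \<le> H2_norm \<beta> f * H2_norm \<beta> g"
      using L2[OF f] L2[OF g] by (intro mult_mono) (auto intro: order_trans[OF L2_set_nonneg])
    finally show ?thesis .
  qed
  have sm: "summable t" by (rule summableI_nonneg_bounded[OF _ bound]) (simp add: t_def)
  then show "summable (\<lambda>k. norm (complex_of_real (\<beta> k) * cinner (f k) (g k)))"
    unfolding t_def .
  show "(\<Sum>k. norm (complex_of_real (\<beta> k) * cinner (f k) (g k))) \<le> H2_norm \<beta> f * H2_norm \<beta> g"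
    using suminf_le_const[OF sm bound] by (simp add: t_def)
qed

lemma H2_cinner_summable:
  assumes "\<And>k. 0 \<le> \<beta> k" "f \<in> H2 \<beta>" "g \<in> H2 \<beta>"
  shows "summable (\<lambda>k. complex_of_real (\<beta> k) * cinner (f k) (g k))"
  using H2_cinner_summable_norm(1)[OF assms] by (rule summable_norm_cancel)

lemma H2_Cauchy_Schwarz:
  assumes "\<And>k. 0 \<le> \<beta> k" "f \<in> H2 \<beta>" "g \<in> H2 \<beta>"
  shows "cmod (H2_cinner \<beta> f g) \<le> H2_norm \<beta> f * H2_norm \<beta> g"
  unfolding H2_cinner_def
  using summable_norm[OF H2_cinner_summable_norm(1)[OF assms]] H2_cinner_summable_norm(2)[OF assms]
  by linarith

lemma H2_norm_nonneg: "(\<And>k. 0 \<le> \<beta> k) \<Longrightarrow> f \<in> H2 \<beta> \<Longrightarrow> 0 \<le> H2_norm \<beta> f"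
  by (auto simp: H2_norm_def H2_def intro!: suminf_nonneg)

lemma H2_cinner_self:
  assumes "\<And>k. 0 \<le> \<beta> k" "f \<in> H2 \<beta>"
  shows "H2_cinner \<beta> f f = complex_of_real ((H2_norm \<beta> f)\<^sup>2)"
proof -
  have "(H2_norm \<beta> f)\<^sup>2 = (\<Sum>k. \<beta> k * (norm (f k))\<^sup>2)"
    using assms by (auto simp: H2_norm_def H2_def intro!: suminf_nonneg)
  moreover have "(\<lambda>k. complex_of_real (\<beta> k * (norm (f k))\<^sup>2)) sums
      complex_of_real (\<Sum>k. \<beta> k * (norm (f k))\<^sup>2)"
    using assms(2) by (intro sums_of_real summable_sums) (simp add: H2_def)
  ultimately show ?thesis
    unfolding H2_cinner_def cinner_self of_real_mult[symmetric] by (simp only: sums_iff)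
qed

text \<open>Pairing the difference with the fixed vector \<open>f n - g n\<close> reduces this to a
  scalar power series vanishing on the disk, whose \<open>n\<close>-th coefficient is
  \<open>(norm (f n - g n))\<^sup>2\<close>.\<close>

lemma represents_unique:
  fixes f g :: "nat \<Rightarrow> 'y::complex_hilbert_space"
  assumes "represents f F" "represents g F"
  shows "f = g"
proof
  fix n
  define a where "a k = cinner (f k - g k) (f n - g n)" for k
  have a: "(\<lambda>k. a k * z ^ k) sums 0" if "norm z < 1" for z
  proof -
    have "(\<lambda>k. z ^ k *\<^sub>C f k - z ^ k *\<^sub>C g k) sums (F z - F z)"
      using assms that by (intro sums_diff) (auto simp: represents_def)
    then have "(\<lambda>k. cinner (z ^ k *\<^sub>C (f k - g k)) (f n - g n)) sums cinner 0 (f n - g n)"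
      unfolding scaleC.diff_right[symmetric] diff_self by (rule bounded_linear.sums[OF cinner.bounded_linear_left])
    then show ?thesis
      unfolding a_def cinner_scaleC_left cinner.zero_left by (simp only: mult.commute)
  qed
  have "a m = 0" for m
  proof (induction m rule: less_induct)
    case (less m)
    \<comment> \<open>The lower coefficients vanish, so \<open>z ^ m\<close> can be divided out; the
      limit at 0 then isolates \<open>a m\<close>.\<close>
    have sums: "(\<lambda>k. a (k + m) * z ^ k) sums 0" if z: "z \<noteq> 0" "norm z < 1" for z
    proof -
      have "(\<lambda>k. a (k + m) * z ^ (k + m)) sums 0"
        using a[OF z(2)] less by (subst sums_zero_iff_shift) auto
      then have "(\<lambda>k. (1 / z ^ m) * (a (k + m) * z ^ (k + m))) sums ((1 / z ^ m) * 0)"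
        by (rule sums_mult)
      moreover have "(1 / z ^ m) * (a (k + m) * z ^ (k + m)) = a (k + m) * z ^ k" for k
        using z(1) by (simp add: power_add)
      ultimately show ?thesis by (simp only: mult_zero_right)
    qed
    have "((\<lambda>z::complex. 0) \<longlongrightarrow> a (0 + m)) (at 0)"
      by (rule powser_limit_0_strong[OF zero_less_one sums])
    then show "a m = 0" using LIM_const_eq[of "0 :: complex" "a m" 0] by simp
  qed
  from this[of n] have "complex_of_real ((norm (f n - g n))\<^sup>2) = 0" unfolding a_def cinner_self .
  then show "f n = g n" by (simp only: of_real_eq_0_iff power_eq_0_iff norm_eq_zero right_minus_eq)
qed

lemma mult_op_eq: "represents g (\<lambda>z. S z (series_eval f z)) \<Longrightarrow> mult_op S f = g"
  unfolding mult_op_def by (rule the_equality) (auto intro: represents_unique)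

lemma series_eval_const: "series_eval (const_series u) z = u"
proof -
  have "series_eval (const_series u) z = (\<Sum>k\<in>{0}. z ^ k *\<^sub>C const_series u k)"
    unfolding series_eval_def by (rule suminf_finite) (auto simp: const_series_def scaleC.zero_right)
  then show ?thesis by (simp add: const_series_def scaleC_one)
qed

lemma H2_finite_support:
  assumes "\<And>k. n \<le> k \<Longrightarrow> f k = 0"
  shows "f \<in> H2 \<beta>" and "H2_norm \<beta> f = sqrt (\<Sum>k<n. \<beta> k * (norm (f k))\<^sup>2)"
  using assms sums_finite[of "{..<n}" "\<lambda>k. \<beta> k * (norm (f k))\<^sup>2"]
  by (auto simp: H2_def H2_norm_def sums_iff not_less)

lemma const_series_H2: "const_series u \<in> H2 \<beta>"
  using H2_finite_support[of 1 "const_series u" \<beta>] by (auto simp: const_series_def)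

section \<open>Observability operators and their gramians\<close>

locale output_stable_pair =
  fixes \<beta> :: "nat \<Rightarrow> real"
    and T :: "'x::complex_hilbert_space \<Rightarrow> 'x"
    and E :: "'x \<Rightarrow> 'y::complex_hilbert_space"
  assumes \<beta>_pos: "0 < \<beta> k"
    and T: "bounded_clinear T" and E: "bounded_clinear E"
    and stable: "output_stable \<beta> E T"
begin

lemma \<beta>_nonneg: "0 \<le> \<beta> k"
  using \<beta>_pos[of k] by simp

lemma observability_H2: "observability \<beta> E T x \<in> H2 \<beta>"
  using stable by (simp add: output_stable_def)

lemma observability_weighted: "\<beta> k *\<^sub>R observability \<beta> E T x k = E ((T ^^ k) x)"
  using \<beta>_pos[of k] by (simp add: observability_def)

text \<open>The weight of the inner product cancels the inverse weight in the observability
  series.\<close>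

lemma H2_cinner_observability:
  "H2_cinner \<beta> h (observability \<beta> E T x) = (\<Sum>k. cinner (h k) (E ((T ^^ k) x)))"
  by (simp add: H2_cinner_def observability_weighted[symmetric] cinner_scaleR_right scaleR_conv_of_real)

lemma summable_observability:
  assumes "h \<in> H2 \<beta>"
  shows "summable (\<lambda>k. cinner (h k) (E ((T ^^ k) x)))"
  using H2_cinner_summable[OF \<beta>_nonneg assms observability_H2]
  by (simp add: observability_weighted[symmetric] cinner_scaleR_right scaleR_conv_of_real)

lemma cinner_hadjoint_observability:
  assumes h: "h \<in> H2 \<beta>"
  shows "cinner (hadjoint (H2_cinner \<beta>) (observability \<beta> E T) h) x = H2_cinner \<beta> h (observability \<beta> E T x)"
proof -
  obtain K where K: "\<And>x. H2_norm \<beta> (observability \<beta> E T x) \<le> K * norm x"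
    using stable by (auto simp: output_stable_def)
  note Tk = bounded_clinear_simps[OF bounded_clinear_pow[OF T]]
  note E' = bounded_clinear_simps[OF E]
  show ?thesis
  proof (rule cinner_hadjoint)
    show "H2_cinner \<beta> h (observability \<beta> E T (x + y)) =
        H2_cinner \<beta> h (observability \<beta> E T x) + H2_cinner \<beta> h (observability \<beta> E T y)" for x y
      unfolding H2_cinner_observability Tk(1) E'(1) cinner_add_right
      by (intro suminf_add[symmetric] summable_observability h)
    show "H2_cinner \<beta> h (observability \<beta> E T (c *\<^sub>C x)) = cnj c * H2_cinner \<beta> h (observability \<beta> E T x)" for c x
      unfolding H2_cinner_observability Tk(2) E'(2) cinner_scaleC_right
      by (intro suminf_mult summable_observability h)
    show "cmod (H2_cinner \<beta> h (observability \<beta> E T x)) \<le> (H2_norm \<beta> h * K) * norm x" for x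
      using H2_Cauchy_Schwarz[OF \<beta>_nonneg h observability_H2, of x]
        mult_left_mono[OF K[of x] H2_norm_nonneg[OF \<beta>_nonneg h]]
      unfolding mult.assoc by (rule order_trans)
  qed
qed

lemma cinner_gramian:
  "cinner (gramian \<beta> E T x) x = complex_of_real ((H2_norm \<beta> (observability \<beta> E T x))\<^sup>2)"
  unfolding gramian_def cinner_hadjoint_observability[OF observability_H2]
  by (rule H2_cinner_self[OF \<beta>_nonneg observability_H2])

lemma norm_observability_sums:
  "(\<lambda>k. inverse (\<beta> k) * (norm (E ((T ^^ k) x)))\<^sup>2) sums (H2_norm \<beta> (observability \<beta> E T x))\<^sup>2"
proof -
  have eq: "\<beta> k * (norm (observability \<beta> E T x k))\<^sup>2 = inverse (\<beta> k) * (norm (E ((T ^^ k) x)))\<^sup>2" for k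
  proof -
    have "norm (observability \<beta> E T x k) = inverse (\<beta> k) * norm (E ((T ^^ k) x))"
      using \<beta>_pos[of k] by (simp add: observability_def)
    moreover have "\<beta> k * (inverse (\<beta> k) * c)\<^sup>2 = inverse (\<beta> k) * c\<^sup>2" for c
      using \<beta>_pos[of k] by (simp add: field_simps power2_eq_square)
    ultimately show ?thesis by (simp only:)
  qed
  have sm: "summable (\<lambda>k. inverse (\<beta> k) * (norm (E ((T ^^ k) x)))\<^sup>2)"
    using observability_H2[of x] unfolding H2_def mem_Collect_eq eq .
  have "0 \<le> (\<Sum>k. inverse (\<beta> k) * (norm (E ((T ^^ k) x)))\<^sup>2)"
    by (rule suminf_nonneg[OF sm]) (simp add: \<beta>_nonneg)
  then have "(H2_norm \<beta> (observability \<beta> E T x))\<^sup>2 = (\<Sum>k. inverse (\<beta> k) * (norm (E ((T ^^ k) x)))\<^sup>2)"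
    unfolding H2_norm_def eq by (rule real_sqrt_pow2)
  then show ?thesis using summable_sums[OF sm] by (simp only:)
qed

end

lemma positive_semidefinite_gramian_diff:
  assumes "output_stable_pair \<beta> T E" "output_stable_pair \<gamma> T N"
  shows "positive_semidefinite (\<lambda>x. gramian \<beta> E T x - gramian \<gamma> N T x) \<longleftrightarrow>
    (\<forall>x. (H2_norm \<gamma> (observability \<gamma> N T x))\<^sup>2 \<le> (H2_norm \<beta> (observability \<beta> E T x))\<^sup>2)"
proof -
  have "cinner (gramian \<beta> E T x - gramian \<gamma> N T x) x = complex_of_real
      ((H2_norm \<beta> (observability \<beta> E T x))\<^sup>2 - (H2_norm \<gamma> (observability \<gamma> N T x))\<^sup>2)" for x
    by (simp only: cinner.diff_left of_real_diff output_stable_pair.cinner_gramian[OF assms(1)]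
        output_stable_pair.cinner_gramian[OF assms(2)])
  then show ?thesis by (simp only: positive_semidefinite_def Reals_of_real Re_complex_of_real) simp
qed

section \<open>Multipliers\<close>

text \<open>Duality: \<open>M\<^sub>S\<close> is applied to a truncation \<open>f\<close> of the
  observability series of \<open>(N, T)\<close>. Pairing the result with that of
  \<open>(E, T)\<close> gives \<open>s\<close>, the squared norm of \<open>f\<close>, so
  \<open>s \<le> sqrt s * O_E\<close> by contractivity.\<close>

lemma multiplier_imp_dominated:
  assumes E: "output_stable_pair \<beta> T E"
    and N: "output_stable_pair unit_weight T N"
    and S: "S \<in> contractive_multipliers \<beta>"
    and left_value: "left_value \<beta> E T S = hadjoint cinner N"
  shows "H2_norm unit_weight (observability unit_weight N T x) \<le> H2_norm \<beta> (observability \<beta> E T x)"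
proof -
  interpret E: output_stable_pair \<beta> T E by fact
  interpret N: output_stable_pair unit_weight T N by fact
  have S_bounded: "bounded_clinear (S z)" if "norm z < 1" for z
    using S that by (simp add: contractive_multipliers_def)
  have S_multiplies: "\<exists>g\<in>H2 \<beta>. represents g (\<lambda>z. S z (series_eval f z)) \<and> H2_norm \<beta> g \<le> H2_norm unit_weight f"
    if "f \<in> H2 unit_weight" for f
    using S that by (simp add: contractive_multipliers_def)
  have "\<exists>g\<in>H2 \<beta>. represents g (\<lambda>z. S z u)" for u
    using S_multiplies[OF const_series_H2, of u] by (auto simp: series_eval_const)
  then obtain g where g: "\<And>u. g u \<in> H2 \<beta>" "\<And>u. represents (g u) (\<lambda>z. S z u)" by metis
  obtain K where K: "\<And>x. norm (N x) \<le> norm x * K"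
    using bounded_clinear_simps(6)[OF N.E] bounded_linear.bounded by blast
  \<comment> \<open>The interpolation condition paired with \<open>x\<close>, as \<open>g u\<close>
    is the power series of \<open>M\<^sub>S u\<close>.\<close>
  have g_observability: "(\<lambda>k. cinner (g u k) (E ((T ^^ k) x))) sums cinner u (N x)" for u x
  proof -
    have "mult_op S (const_series u) = g u" by (rule mult_op_eq) (simp add: series_eval_const g)
    then have "H2_cinner \<beta> (g u) (observability \<beta> E T x) = cinner (left_value \<beta> E T S u) x"
      by (simp add: left_value_def E.cinner_hadjoint_observability g)
    also have "\<dots> = cinner u (N x)"
      unfolding left_value
    proof (rule cinner_hadjoint)
      show "cmod (cinner u (N x)) \<le> (norm u * K) * norm x" for x
        using cinner_norm_bound[of u "N x"] mult_left_mono[OF K[of x], of "norm u"] by (simp add: mult_ac)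
    qed (simp_all add: bounded_clinear_simps[OF N.E] cinner_add_right cinner_scaleC_right)
    finally show ?thesis
      using E.summable_observability[OF g(1)] by (simp add: sums_iff E.H2_cinner_observability)
  qed
  define O_E where "O_E = H2_norm \<beta> (observability \<beta> E T x)"
  have O_E: "0 \<le> O_E" unfolding O_E_def by (rule H2_norm_nonneg[OF E.\<beta>_nonneg E.observability_H2])
  have partial: "(\<Sum>j<n. (norm (N ((T ^^ j) x)))\<^sup>2) \<le> O_E\<^sup>2" for n
  proof -
    define s where "s = (\<Sum>j<n. (norm (N ((T ^^ j) x)))\<^sup>2)"
    have s: "0 \<le> s" by (simp add: s_def sum_nonneg)
    define f where "f j = (if j < n then N ((T ^^ j) x) else 0)" for j
    have f: "f \<in> H2 unit_weight" "H2_norm unit_weight f = sqrt s"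
      using H2_finite_support[of n f unit_weight] by (auto simp: f_def s_def)
    obtain h where h: "h \<in> H2 \<beta>" "represents h (\<lambda>z. S z (series_eval f z))" "H2_norm \<beta> h \<le> sqrt s"
      using S_multiplies[OF f(1)] f(2) by auto
    \<comment> \<open>By pointwise linearity \<open>M\<^sub>S f\<close> is the sum of the shifts
      \<open>z\<^sup>j g (f j)\<close>; uniqueness of power series identifies it with
      \<open>h\<close>.\<close>
    have "represents (\<lambda>m. \<Sum>j<n. if j \<le> m then g (f j) (m - j) else 0) (\<lambda>z. S z (series_eval f z))"
      unfolding represents_def
    proof
      fix z :: complex assume "z \<in> ball 0 1"
      then have z: "norm z < 1" by simp
      note Sz = bounded_clinear_simps[OF S_bounded[OF z]]
      have "(\<lambda>m. if j \<le> m then z ^ m *\<^sub>C g (f j) (m - j) else 0) sums (z ^ j *\<^sub>C S z (f j))" for j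
      proof -
        have "(\<lambda>k. z ^ j *\<^sub>C z ^ k *\<^sub>C g (f j) k) sums (z ^ j *\<^sub>C S z (f j))"
          using g(2)[of "f j"] z
          by (intro bounded_linear.sums[OF scaleC.bounded_linear_right]) (simp add: represents_def)
        then show ?thesis
          using sums_zero_iff_shift[of j "\<lambda>m. if j \<le> m then z ^ m *\<^sub>C g (f j) (m - j) else 0"]
          by (simp add: scaleC_scaleC power_add mult.commute)
      qed
      then have "(\<lambda>m. \<Sum>j<n. if j \<le> m then z ^ m *\<^sub>C g (f j) (m - j) else 0) sums (\<Sum>j<n. z ^ j *\<^sub>C S z (f j))"
        by (intro sums_sum)
      moreover have "series_eval f z = (\<Sum>j<n. z ^ j *\<^sub>C f j)"
        unfolding series_eval_def by (rule suminf_finite) (auto simp: f_def scaleC.zero_right)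
      moreover have "z ^ m *\<^sub>C (\<Sum>j<n. if j \<le> m then g (f j) (m - j) else 0) =
          (\<Sum>j<n. if j \<le> m then z ^ m *\<^sub>C g (f j) (m - j) else 0)" for m
        by (auto simp: scaleC.sum_right scaleC.zero_right intro!: sum.cong)
      ultimately show "(\<lambda>m. z ^ m *\<^sub>C (\<Sum>j<n. if j \<le> m then g (f j) (m - j) else 0)) sums S z (series_eval f z)"
        by (simp add: linear_sum[OF Sz(5)] Sz)
    qed
    with h(2) have h_eq: "h = (\<lambda>m. \<Sum>j<n. if j \<le> m then g (f j) (m - j) else 0)"
      by (rule represents_unique)
    \<comment> \<open>A shift by \<open>j\<close> turns \<open>x\<close> into
      \<open>(T ^^ j) x\<close> in the interpolation condition.\<close>
    have "(\<lambda>m. if j \<le> m then cinner (g (f j) (m - j)) (E ((T ^^ m) x)) else 0) sums cinner (f j) (N ((T ^^ j) x))" for j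
      using sums_zero_iff_shift[of j "\<lambda>m. if j \<le> m then cinner (g (f j) (m - j)) (E ((T ^^ m) x)) else 0"]
        g_observability[of "f j" "(T ^^ j) x"] by (simp add: funpow_add)
    then have "(\<lambda>m. \<Sum>j<n. if j \<le> m then cinner (g (f j) (m - j)) (E ((T ^^ m) x)) else 0) sums
        (\<Sum>j<n. cinner (f j) (N ((T ^^ j) x)))"
      by (intro sums_sum)
    moreover have "(\<Sum>j<n. if j \<le> m then cinner (g (f j) (m - j)) (E ((T ^^ m) x)) else 0) =
        cinner (h m) (E ((T ^^ m) x))" for m
      by (auto simp: h_eq cinner.sum_left cinner.zero_left intro!: sum.cong)
    moreover have "(\<Sum>j<n. cinner (f j) (N ((T ^^ j) x))) = complex_of_real s"
      by (simp add: f_def s_def cinner_self)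
    ultimately have "H2_cinner \<beta> h (observability \<beta> E T x) = complex_of_real s"
      by (simp add: E.H2_cinner_observability sums_iff)
    then have "s \<le> H2_norm \<beta> h * O_E"
      using H2_Cauchy_Schwarz[OF E.\<beta>_nonneg h(1) E.observability_H2, of x] s by (simp add: O_E_def)
    also have "\<dots> \<le> sqrt s * O_E" using h(3) O_E by (rule mult_right_mono)
    finally have "sqrt s * sqrt s \<le> sqrt s * O_E" using s by simp
    then have "sqrt s \<le> O_E"
      using s O_E mult_left_le_imp_le[of "sqrt s" "sqrt s" O_E] by (cases "s = 0") auto
    then show ?thesis using s by (simp add: s_def[symmetric] sqrt_le_D)
  qed
  have "(\<lambda>j. (norm (N ((T ^^ j) x)))\<^sup>2) sums (H2_norm unit_weight (observability unit_weight N T x))\<^sup>2"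
    using N.norm_observability_sums[of x] by simp
  then have "(H2_norm unit_weight (observability unit_weight N T x))\<^sup>2 \<le> O_E\<^sup>2"
    using suminf_le_const[OF _ partial] by (simp add: sums_iff)
  then show ?thesis unfolding O_E_def[symmetric] using O_E by (rule power2_le_imp_le)
qed

text \<open>The triangular partial sums are compared with square ones; the discrepancy is dominated
  by the same discrepancy for the scalar series \<open>\<alpha>\<close> and
  \<open>norm (b j)\<close>, where the usual Cauchy product applies.\<close>

lemma bounded_Cauchy_product_sums:
  fixes A :: "nat \<Rightarrow> 'a::banach \<Rightarrow> 'b::banach"
  assumes A: "\<And>k. linear (A k)" "\<And>k v. norm (A k v) \<le> \<alpha> k * norm v"
    and \<alpha>: "summable \<alpha>" "\<And>k. 0 \<le> \<alpha> k" and b: "summable (\<lambda>j. norm (b j))"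
  shows "(\<lambda>n. \<Sum>j\<le>n. A (n - j) (b j)) sums (\<Sum>k. A k (\<Sum>j. b j))"
proof -
  define s where "s = (\<Sum>j. b j)"
  \<comment> \<open>The square of index pairs without the triangle.\<close>
  define D where "D n = {..<n} \<times> {..<n} - {(j, k). j + k < n}" for n :: nat
  have sub: "{(j, k). j + k < n} \<subseteq> {..<n} \<times> {..<n}" for n :: nat by auto
  have split: "(\<Sum>(j, k)\<in>D n. f j k) = (\<Sum>j<n. \<Sum>k<n. f j k) - (\<Sum>m<n. \<Sum>j\<le>m. f j (m - j))"
    for n and f :: "nat \<Rightarrow> nat \<Rightarrow> 'c::real_normed_vector"
    unfolding D_def by (subst sum_diff[OF _ sub]) (simp_all add: sum.triangle_reindex sum.cartesian_product)
  have sums_A: "(\<lambda>k. A k s) sums (\<Sum>k. A k s)"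
    by (rule summable_sums, rule summable_comparison_test'[OF summable_mult2[OF \<alpha>(1)]]) (rule A)
  have "(\<lambda>n. (\<Sum>j<n. norm (b j)) * suminf \<alpha>) \<longlonglongrightarrow> (\<Sum>j. norm (b j)) * suminf \<alpha>"
    by (intro tendsto_intros summable_LIMSEQ b)
  have prod_\<alpha>: "(\<lambda>m. \<Sum>j\<le>m. norm (b j) * \<alpha> (m - j)) sums ((\<Sum>j. norm (b j)) * suminf \<alpha>)"
    using \<alpha> b by (intro Cauchy_product_sums) auto
  have "(\<lambda>n. (\<Sum>j<n. norm (b j)) * (\<Sum>k<n. \<alpha> k) - (\<Sum>m<n. \<Sum>j\<le>m. norm (b j) * \<alpha> (m - j)))
      \<longlonglongrightarrow> (\<Sum>j. norm (b j)) * suminf \<alpha> - (\<Sum>j. norm (b j)) * suminf \<alpha>"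
    using prod_\<alpha> by (intro tendsto_intros summable_LIMSEQ \<alpha> b) (simp add: sums_def)
  then have D_0: "(\<lambda>n. \<Sum>(j, k)\<in>D n. norm (b j) * \<alpha> k) \<longlonglongrightarrow> 0"
    by (simp add: split sum_product)
  have "norm (\<Sum>(j, k)\<in>D n. A k (b j)) \<le> (\<Sum>(j, k)\<in>D n. norm (b j) * \<alpha> k)" for n
    by (rule order_trans[OF norm_sum], rule sum_mono) (auto simp: A(2) mult.commute)
  with D_0 have D_A: "(\<lambda>n. \<Sum>(j, k)\<in>D n. A k (b j)) \<longlonglongrightarrow> 0"
    by - (rule Lim_null_comparison, auto)
  \<comment> \<open>Error made in the square sums when the partial sum of \<open>b\<close> replaces
    its limit \<open>s\<close>.\<close>
  have "(\<lambda>n. suminf \<alpha> * norm (s - (\<Sum>j<n. b j))) \<longlonglongrightarrow> suminf \<alpha> * norm (s - s)"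
    unfolding s_def by (intro tendsto_intros summable_LIMSEQ summable_norm_cancel[OF b])
  moreover have "norm (\<Sum>k<n. A k (s - (\<Sum>j<n. b j))) \<le> suminf \<alpha> * norm (s - (\<Sum>j<n. b j))" for n
  proof -
    have "norm (\<Sum>k<n. A k (s - (\<Sum>j<n. b j))) \<le> (\<Sum>k<n. \<alpha> k * norm (s - (\<Sum>j<n. b j)))"
      by (rule order_trans[OF norm_sum], rule sum_mono) (rule A)
    also have "\<dots> \<le> suminf \<alpha> * norm (s - (\<Sum>j<n. b j))"
      unfolding sum_distrib_right[symmetric] using \<alpha> by (intro mult_right_mono sum_le_suminf) auto
    finally show ?thesis .
  qed
  ultimately have "(\<lambda>n. \<Sum>k<n. A k (s - (\<Sum>j<n. b j))) \<longlonglongrightarrow> 0"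
    by - (rule Lim_null_comparison, auto)
  from tendsto_diff[OF tendsto_diff[OF sums_A[unfolded sums_def] this] D_A]
  have "(\<lambda>n. (\<Sum>k<n. A k s) - (\<Sum>k<n. A k (s - (\<Sum>j<n. b j))) - (\<Sum>(j, k)\<in>D n. A k (b j))) \<longlonglongrightarrow> (\<Sum>k. A k s)"
    by simp
  moreover have "(\<Sum>k<n. A k s) - (\<Sum>k<n. A k (s - (\<Sum>j<n. b j))) - (\<Sum>(j, k)\<in>D n. A k (b j)) =
      (\<Sum>m<n. \<Sum>j\<le>m. A (m - j) (b j))" for n
  proof -
    have "(\<Sum>k<n. A k s) - (\<Sum>k<n. A k (s - (\<Sum>j<n. b j))) = (\<Sum>k<n. \<Sum>j<n. A k (b j))"
      by (simp add: linear_diff[OF A(1)] sum_subtractf linear_sum[OF A(1)])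
    also have "\<dots> = (\<Sum>j<n. \<Sum>k<n. A k (b j))" by (rule sum.swap)
    finally show ?thesis by (simp add: split)
  qed
  ultimately show ?thesis by (simp add: sums_def s_def)
qed

text \<open>The liminf condition makes \<open>\<beta> j\<close> eventually exceed
  \<open>(q\<^sup>2) ^ j\<close> for any \<open>q < 1\<close>. With \<open>r < q\<close> the terms
  are dominated by a geometric series of ratio \<open>r / q\<close>.\<close>

lemma weight_sequence_summable:
  assumes \<beta>: "weight_sequence \<beta>" and r: "0 \<le> r" "r < 1"
  shows "summable (\<lambda>k. r ^ k / sqrt (\<beta> k))"
proof -
  define q where "q = (r + 1) / 2"
  have q: "r < q" "0 < q" "q < 1" using r by (auto simp: q_def)
  have "ereal (q\<^sup>2) < 1" using q by (simp add: power_less_one_iff abs_square_less_1)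
  also have "1 \<le> liminf (\<lambda>j. ereal (root j (\<beta> j)))" using \<beta> by (simp add: weight_sequence_def)
  finally have "\<forall>\<^sub>F j in sequentially. ereal (q\<^sup>2) < ereal (root j (\<beta> j))" by (rule less_LiminfD)
  then have "\<forall>\<^sub>F j in sequentially. norm (r ^ j / sqrt (\<beta> j)) \<le> (r / q) ^ j"
    using eventually_gt_at_top[of 0]
  proof eventually_elim
    case (elim j)
    have pos: "0 < \<beta> j" using \<beta> by (simp add: weight_sequence_def)
    have "(q\<^sup>2) ^ j \<le> (root j (\<beta> j)) ^ j" using elim q by (intro power_mono) auto
    then have "(q ^ j)\<^sup>2 \<le> \<beta> j" using elim pos by (simp add: power_mult[symmetric] mult.commute)
    then have "q ^ j \<le> sqrt (\<beta> j)" by (rule real_le_rsqrt)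
    then have "r ^ j / sqrt (\<beta> j) \<le> r ^ j / q ^ j" using q r pos by (intro divide_left_mono) auto
    then show ?case using r pos by (simp add: power_divide)
  qed
  then show ?thesis
    by (rule summable_comparison_test_ev) (use q r in \<open>auto intro!: summable_geometric\<close>)
qed

instance complex_hilbert_space \<subseteq> banach ..

locale coefficient_multiplier =
  fixes \<beta> :: "nat \<Rightarrow> real" and S :: "nat \<Rightarrow> 'u::complex_hilbert_space \<Rightarrow> 'y::complex_hilbert_space"
  assumes \<beta>: "weight_sequence \<beta>"
    and S: "bounded_clinear (S k)"
    and contractive: "(\<Sum>m<n. \<beta> m * (norm (\<Sum>j\<le>m. S (m - j) (f j)))\<^sup>2) \<le> (\<Sum>j<n. (norm (f j))\<^sup>2)"
begin

lemma \<beta>_pos: "0 < \<beta> k"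
  using \<beta> by (simp add: weight_sequence_def)

text \<open>Contractivity at the constant function \<open>u\<close>, keeping only the term of degree
  \<open>k\<close>.\<close>

lemma norm_coefficient: "norm (S k u) \<le> norm u / sqrt (\<beta> k)"
proof -
  have "\<beta> k * (norm (\<Sum>j\<le>k. S (k - j) (const_series u j)))\<^sup>2
      \<le> (\<Sum>m<Suc k. \<beta> m * (norm (\<Sum>j\<le>m. S (m - j) (const_series u j)))\<^sup>2)"
    by (rule member_le_sum[where f = "\<lambda>m. \<beta> m * (norm (\<Sum>j\<le>m. S (m - j) (const_series u j)))\<^sup>2"])
      (auto simp: less_imp_le[OF \<beta>_pos])
  also have "\<dots> \<le> (\<Sum>j<Suc k. (norm (const_series u j))\<^sup>2)" by (rule contractive)
  also have "\<dots> = (norm u)\<^sup>2"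
    unfolding sum.lessThan_Suc_shift by (simp add: const_series_def)
  also have "(\<Sum>j\<le>k. S (k - j) (const_series u j)) = (\<Sum>j\<in>{0}. S (k - j) (const_series u j))"
    by (rule sum.mono_neutral_right) (auto simp: const_series_def bounded_clinear_simps[OF S])
  finally have "(sqrt (\<beta> k) * norm (S k u))\<^sup>2 \<le> (norm u)\<^sup>2"
    using \<beta>_pos[of k] by (simp add: const_series_def power_mult_distrib)
  then have "sqrt (\<beta> k) * norm (S k u) \<le> norm u" by (rule power2_le_imp_le) simp
  then show ?thesis using \<beta>_pos[of k] by (simp add: field_simps)
qed

lemma norm_term: "norm (z ^ k *\<^sub>C S k u) \<le> (norm z ^ k / sqrt (\<beta> k)) * norm u"
  using mult_left_mono[OF norm_coefficient[of k u], of "norm z ^ k"] by (simp add: norm_scaleC norm_power)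

lemma summable_term:
  assumes "norm z < 1"
  shows "summable (\<lambda>k. z ^ k *\<^sub>C S k u)"
  using summable_mult2[OF weight_sequence_summable[OF \<beta> norm_ge_zero assms]]
  by (rule summable_comparison_test') (rule norm_term)

lemma bounded_clinear_sum:
  assumes z: "norm z < 1"
  shows "bounded_clinear (\<lambda>u. \<Sum>k. z ^ k *\<^sub>C S k u)"
  unfolding bounded_clinear_def
proof (intro conjI allI)
  note S' = bounded_clinear_simps[OF S]
  have scaleC: "(\<Sum>k. z ^ k *\<^sub>C S k (c *\<^sub>C u)) = c *\<^sub>C (\<Sum>k. z ^ k *\<^sub>C S k u)" for c u
  proof -
    have "(\<Sum>k. z ^ k *\<^sub>C S k (c *\<^sub>C u)) = (\<Sum>k. c *\<^sub>C z ^ k *\<^sub>C S k u)"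
      by (simp only: S' scaleC_scaleC mult.commute)
    also have "\<dots> = c *\<^sub>C (\<Sum>k. z ^ k *\<^sub>C S k u)"
      by (rule bounded_linear.suminf[OF scaleC.bounded_linear_right summable_term[OF z], symmetric])
    finally show ?thesis .
  qed
  then show "(\<Sum>k. z ^ k *\<^sub>C S k (c *\<^sub>C u)) = c *\<^sub>C (\<Sum>k. z ^ k *\<^sub>C S k u)" for c u .
  note sm = weight_sequence_summable[OF \<beta> norm_ge_zero z]
  show "bounded_linear (\<lambda>u. \<Sum>k. z ^ k *\<^sub>C S k u)"
  proof (rule bounded_linear_intro)
    show "(\<Sum>k. z ^ k *\<^sub>C S k (u + v)) = (\<Sum>k. z ^ k *\<^sub>C S k u) + (\<Sum>k. z ^ k *\<^sub>C S k v)" for u v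
      unfolding S'(1) scaleC_add_right by (intro suminf_add[symmetric] summable_term z)
    show "(\<Sum>k. z ^ k *\<^sub>C S k (r *\<^sub>R u)) = r *\<^sub>R (\<Sum>k. z ^ k *\<^sub>C S k u)" for r u
      unfolding scaleR_scaleC by (rule scaleC)
    show "norm (\<Sum>k. z ^ k *\<^sub>C S k u) \<le> norm u * (\<Sum>k. norm z ^ k / sqrt (\<beta> k))" for u
    proof -
      have "norm (\<Sum>k. z ^ k *\<^sub>C S k u) \<le> (\<Sum>k. (norm z ^ k / sqrt (\<beta> k)) * norm u)"
        by (rule norm_suminf_le[OF norm_term summable_mult2[OF sm]])
      also have "\<dots> = norm u * (\<Sum>k. norm z ^ k / sqrt (\<beta> k))"
        unfolding suminf_mult2[OF sm, symmetric] by (rule mult.commute)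
      finally show ?thesis .
    qed
  qed
qed

text \<open>The coefficients of \<open>f\<close> are bounded, so \<open>z ^ j *\<^sub>C f j\<close>
  is absolutely summable and the operator Cauchy product applies.\<close>

lemma represents_product:
  assumes "f \<in> H2 unit_weight"
  shows "represents (\<lambda>n. \<Sum>j\<le>n. S (n - j) (f j)) (\<lambda>z. \<Sum>k. z ^ k *\<^sub>C S k (series_eval f z))"
  unfolding represents_def
proof
  fix z :: complex assume "z \<in> ball 0 1"
  then have z: "norm z < 1" by simp
  note S' = bounded_clinear_simps[OF S]
  define M where "M = (\<Sum>j. (norm (f j))\<^sup>2)"
  have M: "(norm (f j))\<^sup>2 \<le> M" for j
    using assms sum_le_suminf[of "\<lambda>j. (norm (f j))\<^sup>2" "{j}"] by (simp add: H2_def M_def)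
  have le: "norm (norm (z ^ j *\<^sub>C f j)) \<le> norm z ^ j * sqrt M" for j
    using mult_left_mono[OF real_le_rsqrt[OF M[of j]], of "norm z ^ j"] by (simp add: norm_scaleC norm_power)
  have "summable (\<lambda>j. norm z ^ j * sqrt M)"
    using z by (intro summable_mult2 summable_geometric) simp
  then have "summable (\<lambda>j. norm (z ^ j *\<^sub>C f j))"
    by (rule summable_comparison_test') (rule le)
  then have "(\<lambda>n. \<Sum>j\<le>n. z ^ (n - j) *\<^sub>C S (n - j) (z ^ j *\<^sub>C f j)) sums
      (\<Sum>k. z ^ k *\<^sub>C S k (\<Sum>j. z ^ j *\<^sub>C f j))"
  proof (intro bounded_Cauchy_product_sums[where \<alpha> = "\<lambda>k. norm z ^ k / sqrt (\<beta> k)"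
        and A = "\<lambda>k u. z ^ k *\<^sub>C S k u"])
    show "linear (\<lambda>u. z ^ k *\<^sub>C S k u)" for k
      by (rule linearI) (simp_all only: S'(1,3) scaleC_add_right scaleC.scaleR_right)
    show "0 \<le> norm z ^ k / sqrt (\<beta> k)" for k using less_imp_le[OF \<beta>_pos[of k]] by simp
  qed (use norm_term weight_sequence_summable[OF \<beta> norm_ge_zero z] in auto)
  moreover have "(\<Sum>j\<le>n. z ^ (n - j) *\<^sub>C S (n - j) (z ^ j *\<^sub>C f j)) = z ^ n *\<^sub>C (\<Sum>j\<le>n. S (n - j) (f j))" for n
    unfolding scaleC.sum_right
    by (rule sum.cong) (simp_all add: S'(2) scaleC_scaleC power_add[symmetric])
  ultimately show "(\<lambda>n. z ^ n *\<^sub>C (\<Sum>j\<le>n. S (n - j) (f j))) sums (\<Sum>k. z ^ k *\<^sub>C S k (series_eval f z))"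
    by (simp only: series_eval_def)
qed

lemma product_H2:
  assumes f: "f \<in> H2 unit_weight"
  shows "(\<lambda>n. \<Sum>j\<le>n. S (n - j) (f j)) \<in> H2 \<beta>"
    and "H2_norm \<beta> (\<lambda>n. \<Sum>j\<le>n. S (n - j) (f j)) \<le> H2_norm unit_weight f"
proof -
  have sm: "summable (\<lambda>j. (norm (f j))\<^sup>2)" using f by (simp add: H2_def)
  have le: "(\<Sum>m<n. \<beta> m * (norm (\<Sum>j\<le>m. S (m - j) (f j)))\<^sup>2) \<le> (\<Sum>j. (norm (f j))\<^sup>2)" for n
    by (rule order_trans[OF contractive sum_le_suminf[OF sm]]) auto
  have sm': "summable (\<lambda>m. \<beta> m * (norm (\<Sum>j\<le>m. S (m - j) (f j)))\<^sup>2)"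
    by (rule summableI_nonneg_bounded[OF _ le]) (simp add: less_imp_le[OF \<beta>_pos])
  then show "(\<lambda>n. \<Sum>j\<le>n. S (n - j) (f j)) \<in> H2 \<beta>" by (simp add: H2_def)
  show "H2_norm \<beta> (\<lambda>n. \<Sum>j\<le>n. S (n - j) (f j)) \<le> H2_norm unit_weight f"
    using suminf_le_const[OF sm' le] by (simp add: H2_norm_def)
qed

lemma multiplier: "(\<lambda>z u. \<Sum>k. z ^ k *\<^sub>C S k u) \<in> contractive_multipliers \<beta>"
  unfolding contractive_multipliers_def
  using bounded_clinear_sum by (auto intro!: bexI[OF _ product_H2(1)] represents_product product_H2(2))

lemma mult_op_const: "mult_op (\<lambda>z u. \<Sum>k. z ^ k *\<^sub>C S k u) (const_series u) = (\<lambda>k. S k u)"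
proof (rule mult_op_eq)
  show "represents (\<lambda>k. S k u) (\<lambda>z. \<Sum>k. z ^ k *\<^sub>C S k (series_eval (const_series u) z))"
    unfolding series_eval_const represents_def using summable_term by (auto intro: summable_sums)
qed

end

text \<open>The real construction gives coefficients \<open>R k\<close>; contractivity and
  interpolation survive the passage to their complex linear parts.\<close>

lemma dominated_imp_multiplier:
  fixes \<beta> :: "nat \<Rightarrow> real"
    and T :: "'x::complex_hilbert_space \<Rightarrow> 'x"
    and E :: "'x \<Rightarrow> 'y::complex_hilbert_space"
    and N :: "'x \<Rightarrow> 'u::complex_hilbert_space"
  assumes \<beta>: "weight_sequence \<beta>" and dec: "decseq \<beta>"
    and E: "output_stable_pair \<beta> T E"
    and N: "output_stable_pair unit_weight T N"
    and dominated: "\<And>x. (H2_norm unit_weight (observability unit_weight N T x))\<^sup>2 \<le>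
      (H2_norm \<beta> (observability \<beta> E T x))\<^sup>2"
  obtains S :: "complex \<Rightarrow> 'u \<Rightarrow> 'y"
  where "S \<in> contractive_multipliers \<beta>" "left_value \<beta> E T S = hadjoint cinner N"
proof -
  interpret E: output_stable_pair \<beta> T E by fact
  interpret N: output_stable_pair unit_weight T N by fact
  note E' = bounded_clinear_simps[OF E.E] and N' = bounded_clinear_simps[OF N.E]
    and Tk = bounded_clinear_simps[OF bounded_clinear_pow[OF E.T]]
  have E_sums: "(\<lambda>k. inverse (\<beta> k) * (norm (E ((T ^^ k) x)))\<^sup>2) sums (H2_norm \<beta> (observability \<beta> E T x))\<^sup>2" for x
    by (rule E.norm_observability_sums)
  have N_sums: "(\<lambda>j. (norm (N ((T ^^ j) x)))\<^sup>2) sums (H2_norm unit_weight (observability unit_weight N T x))\<^sup>2" for x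
    using N.norm_observability_sums[of x] by simp
  interpret interpolation_data \<beta> T E N
  proof (rule interpolation_data.intro)
    show "(\<Sum>j<J. (norm (N ((T ^^ j) x)))\<^sup>2) \<le> (\<Sum>k. inverse (\<beta> k) * (norm (E ((T ^^ k) x)))\<^sup>2)" for J x
    proof -
      have "(\<Sum>j<J. (norm (N ((T ^^ j) x)))\<^sup>2) \<le> (\<Sum>j. (norm (N ((T ^^ j) x)))\<^sup>2)"
        using sums_summable[OF N_sums] by (rule sum_le_suminf) auto
      also have "\<dots> \<le> (\<Sum>k. inverse (\<beta> k) * (norm (E ((T ^^ k) x)))\<^sup>2)"
        unfolding sums_unique[OF N_sums, symmetric] sums_unique[OF E_sums, symmetric] by (rule dominated)
      finally show ?thesis .
    qed
    show "summable (\<lambda>k. inverse (\<beta> k) * (norm (E ((T ^^ k) x)))\<^sup>2)" for x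
      by (rule sums_summable[OF E_sums])
    show "linear T" by (rule bounded_clinear_simps(5)[OF E.T])
  qed (use E.\<beta>_pos dec E'(5) N'(5) in auto)
  obtain R :: "nat \<Rightarrow> 'u \<Rightarrow> 'y" where R: "\<And>k. bounded_linear (R k)"
    and R_contractive: "\<And>f n. (\<Sum>m<n. \<beta> m * (norm (\<Sum>j\<le>m. R (m - j) (f j)))\<^sup>2) \<le> (\<Sum>j<n. (norm (f j))\<^sup>2)"
    and R_interpolates: "\<And>u x. (\<lambda>k. inner (R k u) (E ((T ^^ k) x))) sums inner u (N x)"
    by (rule real_multiplier) (rule that)
  text \<open>\<open>S k\<close> is the complex linear part of \<open>R k\<close>.\<close>
  define S where "S k u = (1 / 2) *\<^sub>R (R k u - \<i> *\<^sub>C R k (\<i> *\<^sub>C u))" for k u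
  have S_bounded_linear: "bounded_linear (S k)" for k
    unfolding S_def
    by (intro bounded_linear_const_scaleR bounded_linear_sub R
        bounded_linear_compose[OF scaleC.bounded_linear_right]
        bounded_linear_compose[OF R scaleC.bounded_linear_right])
  interpret S: coefficient_multiplier \<beta> S
  proof (rule coefficient_multiplier.intro)
    show "bounded_clinear (S k)" for k
      unfolding bounded_clinear_def
    proof (intro conjI allI S_bounded_linear)
      fix c u
      have R_neg: "R k (- u) = - R k u" for u using linear_neg[OF bounded_linear.linear[OF R]] .
      have S_i: "S k (\<i> *\<^sub>C u) = \<i> *\<^sub>C S k u" for u
        by (simp add: S_def scaleC.scaleR_right scaleC.diff_right scaleC_ii R_neg scaleC.minus_right)
      have c: "c *\<^sub>C v = Re c *\<^sub>R v + Im c *\<^sub>R \<i> *\<^sub>C v" for v :: "'a::complex_hilbert_space"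
      proof -
        have "c = complex_of_real (Re c) + complex_of_real (Im c) * \<i>" by (simp add: complex_eq_iff)
        then have "c *\<^sub>C v = (complex_of_real (Re c) + complex_of_real (Im c) * \<i>) *\<^sub>C v" by (rule arg_cong)
        then show ?thesis by (simp only: scaleC_add_left scaleC_scaleC[symmetric] scaleC_of_real)
      qed
      show "S k (c *\<^sub>C u) = c *\<^sub>C S k u"
        unfolding c by (simp only: linear_simps(1,5)[OF S_bounded_linear] S_i)
    qed
    show "(\<Sum>m<n. \<beta> m * (norm (\<Sum>j\<le>m. S (m - j) (f j)))\<^sup>2) \<le> (\<Sum>j<n. (norm (f j))\<^sup>2)" for n f
    proof -
      \<comment> \<open>The product with \<open>S\<close> is the mean of \<open>P\<close> and
        \<open>- \<i> P'\<close>. The inputs \<open>f\<close> and \<open>\<i> f\<close> have equal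
        norms, so convexity of the square preserves the bound.\<close>
      define P where "P m = (\<Sum>j\<le>m. R (m - j) (f j))" for m
      define P' where "P' m = (\<Sum>j\<le>m. R (m - j) (\<i> *\<^sub>C f j))" for m
      have "(norm (\<Sum>j\<le>m. S (m - j) (f j)))\<^sup>2 \<le> ((norm (P m))\<^sup>2 + (norm (P' m))\<^sup>2) / 2" for m
      proof -
        have "(\<Sum>j\<le>m. S (m - j) (f j)) = (1 / 2) *\<^sub>R (P m - \<i> *\<^sub>C P' m)"
          unfolding S_def P_def P'_def scaleC.sum_right by (simp only: scaleR_sum_right[symmetric] sum_subtractf)
        then have "norm (\<Sum>j\<le>m. S (m - j) (f j)) \<le> (norm (P m) + norm (P' m)) / 2"
          using norm_triangle_ineq4[of "P m" "\<i> *\<^sub>C P' m"] by (simp add: norm_scaleC)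
        then have "(norm (\<Sum>j\<le>m. S (m - j) (f j)))\<^sup>2 \<le> ((norm (P m) + norm (P' m)) / 2)\<^sup>2"
          by (rule power_mono) simp
        also have "\<dots> \<le> ((norm (P m))\<^sup>2 + (norm (P' m))\<^sup>2) / 2"
          using sum_squares_bound[of "norm (P m)" "norm (P' m)"] by (simp add: power2_sum power_divide)
        finally show ?thesis .
      qed
      then have "(\<Sum>m<n. \<beta> m * (norm (\<Sum>j\<le>m. S (m - j) (f j)))\<^sup>2) \<le>
          (\<Sum>m<n. \<beta> m * (((norm (P m))\<^sup>2 + (norm (P' m))\<^sup>2) / 2))"
        by (intro sum_mono mult_left_mono E.\<beta>_nonneg)
      also have "\<dots> = ((\<Sum>m<n. \<beta> m * (norm (P m))\<^sup>2) + (\<Sum>m<n. \<beta> m * (norm (P' m))\<^sup>2)) / 2"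
        by (simp add: distrib_left sum.distrib sum_divide_distrib add_divide_distrib)
      also have "\<dots> \<le> ((\<Sum>j<n. (norm (f j))\<^sup>2) + (\<Sum>j<n. (norm (\<i> *\<^sub>C f j))\<^sup>2)) / 2"
        unfolding P_def P'_def by (intro divide_right_mono add_mono R_contractive) simp
      finally show ?thesis by (simp add: norm_scaleC)
    qed
  qed (rule \<beta>)
  have S_interpolates: "(\<lambda>k. inner (S k u) (E ((T ^^ k) x))) sums inner u (N x)" for u x
  proof -
    \<comment> \<open>Interpolation at \<open>(u, x)\<close> and at \<open>(\<i> u, \<i> x)\<close>
      is averaged; moving \<open>\<i>\<close> across the inner product produces \<open>S k\<close>,
      and both limits equal \<open>inner u (N x)\<close>.\<close>
    have "(\<lambda>k. (1 / 2) * (inner (R k u) (E ((T ^^ k) x)) + inner (R k (\<i> *\<^sub>C u)) (E ((T ^^ k) (\<i> *\<^sub>C x))))) sums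
        ((1 / 2) * (inner u (N x) + inner (\<i> *\<^sub>C u) (N (\<i> *\<^sub>C x))))"
      by (intro sums_mult sums_add R_interpolates)
    then show ?thesis
      by (simp add: S_def inner_diff_left inner_ii_left scaleC_ii Tk(2) E'(2) N'(2))
  qed
  \<comment> \<open>The imaginary part is the real identity at
    \<open>\<i> *\<^sub>C x\<close>.\<close>
  have "(\<lambda>k. cinner (S k u) (E ((T ^^ k) x))) sums cinner u (N x)" for u x
    using S_interpolates[of u x] S_interpolates[of u "\<i> *\<^sub>C x"]
    by (simp add: sums_complex_iff Re_cinner Im_cinner Tk(2) E'(2) N'(2))
  then have "H2_cinner \<beta> (\<lambda>k. S k u) (observability \<beta> E T x) = cinner u (N x)" for u x
    by (simp add: E.H2_cinner_observability sums_iff)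
  \<comment> \<open>Both sides are definite descriptions with the same defining condition.\<close>
  then have "left_value \<beta> E T (\<lambda>z u. \<Sum>k. z ^ k *\<^sub>C S k u) = hadjoint cinner N"
    by (intro ext) (simp add: left_value_def hadjoint_def S.mult_op_const)
  with S.multiplier show ?thesis by (rule that)
qed

theorem theorem3p6:
  fixes \<beta> :: "nat \<Rightarrow> real"
    and T :: "'x::complex_hilbert_space \<Rightarrow> 'x"
    and E :: "'x \<Rightarrow> 'y::complex_hilbert_space"
    and N :: "'x \<Rightarrow> 'u::complex_hilbert_space"
  assumes "weight_sequence \<beta>"
    and "decseq \<beta>"
    and "bounded_clinear T"
    and "bounded_clinear E"
    and "bounded_clinear N"
    and "output_stable \<beta> E T"
    and "output_stable unit_weight N T"
  shows "(\<exists>S :: complex \<Rightarrow> 'u \<Rightarrow> 'y. S \<in> contractive_multipliers \<beta> \<and>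
            left_value \<beta> E T S = hadjoint cinner N) \<longleftrightarrow>
         positive_semidefinite (\<lambda>x. gramian \<beta> E T x - gramian unit_weight N T x)"
proof -
  have \<beta>_pos: "\<And>k. 0 < \<beta> k" using assms(1) by (auto simp: weight_sequence_def)
  have E: "output_stable_pair \<beta> T E" and N: "output_stable_pair unit_weight T N"
    using assms \<beta>_pos by (auto simp: output_stable_pair_def)
  interpret N: output_stable_pair unit_weight T N by (rule N)
  show ?thesis
    \<comment> \<open>The quadratic forms of the gramians are squared norms of observability series,
      so only a comparison of norms is left.\<close>
    unfolding positive_semidefinite_gramian_diff[OF E N]
  proof (intro iffI allI)
    fix x
    assume "\<exists>S :: complex \<Rightarrow> 'u \<Rightarrow> 'y. S \<in> contractive_multipliers \<beta> \<and>
            left_value \<beta> E T S = hadjoint cinner N"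
    then show "(H2_norm unit_weight (observability unit_weight N T x))\<^sup>2 \<le>
        (H2_norm \<beta> (observability \<beta> E T x))\<^sup>2"
      using multiplier_imp_dominated[OF E N]
        H2_norm_nonneg[OF N.\<beta>_nonneg N.observability_H2] by (blast intro: power_mono)
  next
    assume "\<forall>x. (H2_norm unit_weight (observability unit_weight N T x))\<^sup>2 \<le>
        (H2_norm \<beta> (observability \<beta> E T x))\<^sup>2"
    then show "\<exists>S :: complex \<Rightarrow> 'u \<Rightarrow> 'y. S \<in> contractive_multipliers \<beta> \<and>
            left_value \<beta> E T S = hadjoint cinner N"
      using dominated_imp_multiplier[OF assms(1,2) E N] by metis
  qed
qed

end
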